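(* Let $p>2$, let $E\subseteq\mathbb{N}$ be a Rudin $\Lambda(p)$ set, and let $\boldsymbol{\lambda}=\{\lambda_n:n\in E\}$ be a sequence of complex numbers (with $\lambda_n=0$ for $n\in\mathbb{N}\setminus E$). Then the following statements are equivalent. (i) The Hankel type operator $\mathcal{H}_{\boldsymbol{\lambda}}$ is compact on the Dirichlet space $\mathcal{D}$. (ii) The Hankel type operator $\mathcal{H}_{\boldsymbol{\lambda}}$ is bounded on $\mathcal{D}$. (iii) The symbol function $h_{\overline{\boldsymbol{\lambda}}}(z)=\sum_{n\in E}\overline{\lambda_n}z^n$ belongs to $\mathcal{D}$; that is, $\sum_{n\in E}(n+1)|\lambda_n|^2<\infty$.
   Context: $\mathbb{N}$ is the set of nonnegative integers, $\mathbb{D}$ is the open unit disk, $\mathbb{T}$ is the unit circle, $H(\mathbb{D})$ is the space of analytic functions on $\mathbb{D}$, and $dA=\pi^{-1}dx\,dy$ is normalized Lebesgue measure on $\mathbb{D}$. For $p>2$, a set $E\subseteq\mathbb{Z}$ is a Rudin $\Lambda(p)$ set if there is a constant $C$ such that $\|f\|_{L^p(\mathbb{T})}\le C\|f\|_{L^2(\mathbb{T})}$ for all trigonometric polynomials $f$ whose Fourier coefficients $\hat f(n)$ vanish for all $n\in\mathbb{Z}\setminus E$. The Dirichlet space $\mathcal{D}$ is the Hilbert space of $f\in H(\mathbb{D})$ with $\|f\|_{\mathcal{D}}^2=|f(0)|^2+\int_{\mathbb{D}}|f'(z)|^2dA(z)<\infty$. For $f(z)=\sum_{k\ge0}a_kz^k\in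 H(\mathbb{D})$, the Hankel type operator is $\mathcal{H}_{\boldsymbol{\lambda}}(f)(z)=\sum_{n=0}^\infty\left(\sum_{k=0}^\infty\lambda_{n+k}a_k\right)z^n$, whenever the right-hand side makes sense and defines an analytic function in $\mathbb{D}$. It is bounded on $\mathcal{D}$ if $\mathcal{H}_{\boldsymbol{\lambda}}(f)$ is well defined in $H(\mathbb{D})$ for every $f\in\mathcal{D}$ and there is a constant $C>0$ with $\|\mathcal{H}_{\boldsymbol{\lambda}}(f)\|_{\mathcal{D}}\le C\|f\|_{\mathcal{D}}$ for all $f\in\mathcal{D}$; it is compact on $\mathcal{D}$ if moreover it is a compact linear operator from $\mathcal{D}$ to $\mathcal{D}$. *)

theory Defs
  imports "HOL-Complex_Analysis.Complex_Analysis"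
begin

text \<open>Functions on the unit circle are represented by functions \<open>complex \<Rightarrow> complex\<close> of
  which only the values \<open>f (cis t)\<close> matter; the circle carries normalized arc length.\<close>

definition circle_Lp_norm :: "real \<Rightarrow> (complex \<Rightarrow> complex) \<Rightarrow> real" where
  "circle_Lp_norm p f =
     ((LINT t:{0..2*pi}|lborel. norm (f (cis t)) powr p) / (2*pi)) powr (1/p)"

definition fourier_coeff :: "(complex \<Rightarrow> complex) \<Rightarrow> int \<Rightarrow> complex" where
  "fourier_coeff f n =
     (LINT t:{0..2*pi}|lborel. f (cis t) * cis (- (of_int n * t))) / (2*pi)"

definition trig_polynomial :: "(complex \<Rightarrow> complex) \<Rightarrow> bool" where
  "trig_polynomial f \<longleftrightarrow>
     (\<exists>S c. finite (S :: int set) \<and> (\<forall>z\<in>sphere 0 1. f z = (\<Sum>n\<in>S. c n * z powi n)))"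

definition Rudin_Lambda :: "real \<Rightarrow> int set \<Rightarrow> bool" where
  "Rudin_Lambda p E \<longleftrightarrow>
     (\<exists>C. \<forall>f. trig_polynomial f \<longrightarrow> (\<forall>n. n \<notin> E \<longrightarrow> fourier_coeff f n = 0)
        \<longrightarrow> circle_Lp_norm p f \<le> C * circle_Lp_norm 2 f)"

text \<open>Functions on the open unit disk are likewise total functions of which only the values
  on \<open>ball 0 1\<close> matter; two of them are the same element of the Dirichlet space
  iff they agree there.\<close>

definition disk_area :: "complex measure" where
  "disk_area = scale_measure (ennreal (1/pi)) (restrict_space lborel (ball 0 1))"

definition Dirichlet_space :: "(complex \<Rightarrow> complex) set" where
  "Dirichlet_space =
     {f. f holomorphic_on ball 0 1 \<and> integrable disk_area (\<lambda>z. (norm (deriv f z))\<^sup>2)}"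

definition Dirichlet_norm :: "(complex \<Rightarrow> complex) \<Rightarrow> real" where
  "Dirichlet_norm f = sqrt ((norm (f 0))\<^sup>2 + (LINT z|disk_area. (norm (deriv f z))\<^sup>2))"

definition taylor_coeff :: "(complex \<Rightarrow> complex) \<Rightarrow> nat \<Rightarrow> complex" where
  "taylor_coeff f k = (deriv ^^ k) f 0 / fact k"

definition hankel_coeff :: "(nat \<Rightarrow> complex) \<Rightarrow> (complex \<Rightarrow> complex) \<Rightarrow> nat \<Rightarrow> complex" where
  "hankel_coeff l f n = (\<Sum>k. l (n + k) * taylor_coeff f k)"

definition hankel :: "(nat \<Rightarrow> complex) \<Rightarrow> (complex \<Rightarrow> complex) \<Rightarrow> complex \<Rightarrow> complex" where
  "hankel l f z = (\<Sum>n. hankel_coeff l f n * z ^ n)"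

definition hankel_well_defined :: "(nat \<Rightarrow> complex) \<Rightarrow> (complex \<Rightarrow> complex) \<Rightarrow> bool" where
  "hankel_well_defined l f \<longleftrightarrow>
     (\<forall>n. summable (\<lambda>k. l (n + k) * taylor_coeff f k)) \<and>
     (\<forall>z\<in>ball 0 1. summable (\<lambda>n. hankel_coeff l f n * z ^ n)) \<and>
     hankel l f holomorphic_on ball 0 1"

text \<open>\<open>Dirichlet_norm\<close> takes a meaningless finite value when the integral diverges, so
  membership of \<open>hankel l f\<close> in the space has to accompany the norm estimate.\<close>

definition hankel_bounded :: "(nat \<Rightarrow> complex) \<Rightarrow> bool" where
  "hankel_bounded l \<longleftrightarrow>
     (\<forall>f\<in>Dirichlet_space. hankel_well_defined l f) \<and>
     (\<exists>C>0. \<forall>f\<in>Dirichlet_space.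
        hankel l f \<in> Dirichlet_space \<and> Dirichlet_norm (hankel l f) \<le> C * Dirichlet_norm f)"

definition Dirichlet_linear :: "((complex \<Rightarrow> complex) \<Rightarrow> complex \<Rightarrow> complex) \<Rightarrow> bool" where
  "Dirichlet_linear T \<longleftrightarrow>
     (\<forall>f\<in>Dirichlet_space. T f \<in> Dirichlet_space) \<and>
     (\<forall>f\<in>Dirichlet_space. \<forall>g\<in>Dirichlet_space. \<forall>z\<in>ball 0 1.
        T (\<lambda>w. f w + g w) z = T f z + T g z) \<and>
     (\<forall>c. \<forall>f\<in>Dirichlet_space. \<forall>z\<in>ball 0 1. T (\<lambda>w. c * f w) z = c * T f z)"

definition Dirichlet_compact_operator ::
    "((complex \<Rightarrow> complex) \<Rightarrow> complex \<Rightarrow> complex) \<Rightarrow> bool" where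
  "Dirichlet_compact_operator T \<longleftrightarrow>
     Dirichlet_linear T \<and>
     (\<forall>F :: nat \<Rightarrow> complex \<Rightarrow> complex.
        (\<forall>j. F j \<in> Dirichlet_space) \<longrightarrow> (\<exists>B. \<forall>j. Dirichlet_norm (F j) \<le> B) \<longrightarrow>
        (\<exists>g\<in>Dirichlet_space. \<exists>r. strict_mono (r :: nat \<Rightarrow> nat) \<and>
           (\<lambda>j. Dirichlet_norm (\<lambda>z. T (F (r j)) z - g z)) \<longlonglongrightarrow> 0))"

definition hankel_compact :: "(nat \<Rightarrow> complex) \<Rightarrow> bool" where
  "hankel_compact l \<longleftrightarrow> hankel_bounded l \<and> Dirichlet_compact_operator (hankel l)"

definition symbol_function :: "nat set \<Rightarrow> (nat \<Rightarrow> complex) \<Rightarrow> complex \<Rightarrow> complex" where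
  "symbol_function E l z = (\<Sum>\<^sub>\<infinity>n\<in>E. l n * z ^ n)"

text \<open>The convergence clause is needed because divergent sums have the value \<open>0\<close> in HOL.\<close>

definition symbol_in_Dirichlet :: "nat set \<Rightarrow> (nat \<Rightarrow> complex) \<Rightarrow> bool" where
  "symbol_in_Dirichlet E l \<longleftrightarrow>
     (\<forall>z\<in>ball 0 1. (\<lambda>n. l n * z ^ n) summable_on E) \<and>
     symbol_function E l \<in> Dirichlet_space"

end

theory Submission
  imports Defs
begin

text \<open>
  For \<open>f = \<Sum>k. a k z ^ k\<close> the square of the Dirichlet norm is comparable to
  \<open>\<Sum>k. (k + 1) \<bar>a k\<bar>\<^sup>2\<close>. Testing the \<open>\<Lambda>(p)\<close> inequality on the polynomials
  \<open>\<Sum>n\<in>A. z ^ n\<close> shows that an interval of length \<open>N\<close> contains \<open>O(N powr (2/p))\<close> elements of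
  \<open>E\<close>; as \<open>2/p < 1\<close>, the sums of \<open>1 / (k + 1)\<close> over all \<open>k\<close> with \<open>j + k \<in> E\<close> are bounded by a
  constant \<open>K\<close> independent of \<open>j\<close>. This is the only property of \<open>E\<close> that is needed:
  Cauchy--Schwarz with the weights \<open>1 / (k + 1)\<close> yields
  \<open>\<Sum>n. (n + 1) \<bar>\<Sum>k. l (n + k) a k\<bar>\<^sup>2 \<le> K * (\<Sum>m. (m + 1) \<bar>l m\<bar>\<^sup>2 * (\<Sum>k\<le>m. (k + 1) \<bar>a k\<bar>\<^sup>2))\<close>,
  which gives boundedness, and compactness by dominated convergence in \<open>m\<close> along a subsequence
  whose Taylor coefficients converge. Conversely, the Hankel operator maps the constant \<open>1\<close> to
  \<open>\<Sum>n. l n z ^ n\<close>.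
\<close>

subsection \<open>Rotation invariance of area measure\<close>

unbundle no fps_syntax

text \<open>Both measures give every box the product of its side lengths. The identification with
  \<open>real^2\<close> makes orthogonal transformations available on the complex plane.\<close>

lemma distr_lborel_vec2_complex:
  "distr lborel borel (\<lambda>v::real^2. Complex (v $ 1) (v $ 2)) = lborel"
proof (rule lborel_eqI[symmetric])
  have [measurable]: "(\<lambda>v::real^2. Complex (v $ 1) (v $ 2)) \<in> borel_measurable borel"
    by (intro borel_measurable_continuous_onI continuous_intros)
  fix l u :: complex
  assume le: "\<And>b. b \<in> Basis \<Longrightarrow> l \<bullet> b \<le> u \<bullet> b"
  have "emeasure (distr lborel borel (\<lambda>v::real^2. Complex (v $ 1) (v $ 2))) (box l u)
     = emeasure lborel ((\<lambda>v::real^2. Complex (v $ 1) (v $ 2)) -` box l u)"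
    by (subst emeasure_distr) auto
  also have "(\<lambda>v::real^2. Complex (v $ 1) (v $ 2)) -` box l u =
     box (vector [Re l, Im l]) (vector [Re u, Im u])"
    by (auto simp: box_def Basis_complex_def Basis_vec_def inner_axis forall_2 vector_2)
  also have "emeasure lborel \<dots> = ennreal (\<Prod>b\<in>Basis. (vector [Re u, Im u] - vector [Re l, Im l] :: real^2) \<bullet> b)"
  proof (rule emeasure_lborel_box)
    fix b :: "real^2"
    assume "b \<in> Basis"
    then obtain i where "b = axis i 1"
      by (auto simp: Basis_vec_def)
    then show "vector [Re l, Im l] \<bullet> b \<le> vector [Re u, Im u] \<bullet> b"
      using le[of 1] le[of \<i>] exhaust_2[of i] by (auto simp: Basis_complex_def inner_axis vector_2)
  qed
  also have "(\<Prod>b\<in>Basis. (vector [Re u, Im u] - vector [Re l, Im l] :: real^2) \<bullet> b) = (\<Prod>b\<in>Basis. (u - l) \<bullet> b)"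
    by (simp add: Basis_complex_def Basis_vec_def inner_axis UNIV_2 vector_2 axis_eq_axis)
  finally show "emeasure (distr lborel borel (\<lambda>v::real^2. Complex (v $ 1) (v $ 2))) (box l u)
     = ennreal (\<Prod>b\<in>Basis. (u - l) \<bullet> b)" .
qed auto

text \<open>The preimage of a box is its image under the inverse, which is again orthogonal and so
  preserves volume; the values on boxes determine the measure.\<close>

lemma distr_lborel_orthogonal_transformation:
  fixes f :: "(real, 'n::{finite,wellorder}) vec \<Rightarrow> (real, 'n) vec"
  assumes f: "orthogonal_transformation f"
  shows "distr lborel borel f = lborel"
proof (rule lborel_eqI[symmetric])
  define g where "g = inv f"
  have g: "orthogonal_transformation g"
    unfolding g_def using f by (rule orthogonal_transformation_inv)
  have f_borel [measurable]: "f \<in> borel_measurable borel"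
    using f by (intro borel_measurable_continuous_onI linear_continuous_on)
      (simp add: linear_linear orthogonal_transformation_linear)
  fix l u :: "(real, 'n) vec"
  assume le: "\<And>b. b \<in> Basis \<Longrightarrow> l \<bullet> b \<le> u \<bullet> b"
  have A': "box l u \<in> lmeasurable"
    by simp
  have inv: "f -` box l u = g ` box l u"
    unfolding g_def using bij_vimage_eq_inv_image[OF orthogonal_transformation_bij[OF f]] by auto
  have "f -` box l u \<in> sets borel"
    by (rule measurable_sets_borel[OF f_borel]) simp
  \<comment> \<open>The preimage is Borel, so \<open>lborel\<close> and \<open>lebesgue\<close>
    agree on it, and orthogonal images keep their \<open>lebesgue\<close> measure.\<close>
  then have "emeasure (distr lborel borel f) (box l u) = emeasure lebesgue (g ` box l u)"
    by (simp add: emeasure_distr inv)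
  also have "\<dots> = ennreal (measure lebesgue (g ` box l u))"
    using measurable_orthogonal_image[OF g A'] by (simp add: emeasure_eq_measure2 fmeasurableD2)
  also have "\<dots> = ennreal (measure lebesgue (box l u))"
    using measure_orthogonal_image[OF g A'] by simp
  also have "\<dots> = ennreal (\<Prod>b\<in>Basis. (u - l) \<bullet> b)"
    using le by simp
  finally show "emeasure (distr lborel borel f) (box l u) = ennreal (\<Prod>b\<in>Basis. (u - l) \<bullet> b)" .
qed auto

text \<open>Under the identification \<open>?\<phi>\<close> with the plane, multiplication by
  \<open>cis t\<close> becomes the rotation matrix \<open>?R\<close>, which is orthogonal.\<close>

lemma distr_lborel_cis_mult: "distr lborel borel (\<lambda>z. cis t * z) = lborel"
proof -
  let ?\<phi> = "\<lambda>v::real^2. Complex (v $ 1) (v $ 2)"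
  let ?R = "\<lambda>v::real^2. (vector [cos t * v $ 1 - sin t * v $ 2, sin t * v $ 1 + cos t * v $ 2] :: real^2)"
  have lin: "linear ?R"
    by (rule linearI) (auto simp: vec_eq_iff forall_2 vector_2 algebra_simps)
  have R: "orthogonal_transformation ?R"
  proof (subst orthogonal_transformation, intro conjI allI lin)
    fix v :: "real^2"
    have "(cos t * v $ 1 - sin t * v $ 2)\<^sup>2 + (sin t * v $ 1 + cos t * v $ 2)\<^sup>2
        = ((sin t)\<^sup>2 + (cos t)\<^sup>2) * ((v $ 1)\<^sup>2 + (v $ 2)\<^sup>2)"
      by algebra
    then show "norm (?R v) = norm v"
      by (simp add: norm_vec_def L2_set_def sum_2 vector_2)
  qed
  have [measurable]: "?\<phi> \<in> borel_measurable borel" "?R \<in> borel_measurable borel"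
    by (intro borel_measurable_continuous_onI continuous_intros)
      (intro borel_measurable_continuous_onI linear_continuous_on, simp add: lin linear_linear)
  have "distr lborel borel (\<lambda>z. cis t * z) = distr (distr lborel borel ?\<phi>) borel (\<lambda>z. cis t * z)"
    by (simp only: distr_lborel_vec2_complex)
  also have "\<dots> = distr lborel borel (?\<phi> \<circ> ?R)"
    by (subst distr_distr) (auto simp: fun_eq_iff complex_eq_iff vector_2 intro!: distr_cong)
  also have "\<dots> = distr (distr lborel borel ?R) borel ?\<phi>"
    by (subst distr_distr) auto
  also have "\<dots> = lborel"
    by (simp only: distr_lborel_orthogonal_transformation[OF R] distr_lborel_vec2_complex)
  finally show ?thesis .
qed

lemma space_disk_area [simp]: "space disk_area = ball 0 1"
  by (simp add: disk_area_def space_restrict_space space_scale_measure)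

lemma sets_disk_area: "sets disk_area = sets (restrict_space borel (ball 0 1))"
  by (simp add: disk_area_def sets_restrict_space)

lemma nn_integral_disk_area:
  assumes "f \<in> borel_measurable disk_area"
  shows "(\<integral>\<^sup>+z. f z \<partial>disk_area) = ennreal (1/pi) * (\<integral>\<^sup>+z. f z * indicator (ball 0 1) z \<partial>lborel)"
proof -
  have "f \<in> borel_measurable (restrict_space lborel (ball 0 1))"
    using assms by (simp add: disk_area_def)
  then show ?thesis
    by (simp add: disk_area_def nn_integral_scale_measure nn_integral_restrict_space)
qed

text \<open>Rotations preserve Lebesgue measure and the disk. Averaging over \<open>t\<close> then
  reduces area integrals to Parseval on circles, without polar coordinates.\<close>

lemma nn_integral_disk_area_rotate:
  assumes f: "f \<in> borel_measurable disk_area"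
  shows "(\<integral>\<^sup>+z. f (cis t * z) \<partial>disk_area) = (\<integral>\<^sup>+z. f z \<partial>disk_area)"
proof -
  have [measurable]: "(\<lambda>z. f z * indicator (ball 0 1) z) \<in> borel_measurable borel"
  proof -
    have "f \<in> borel_measurable (restrict_space lborel (ball 0 1))"
      using f by (simp add: disk_area_def)
    then show ?thesis
      by (subst (asm) borel_measurable_restrict_space_iff_ennreal) auto
  qed
  have rot: "(\<lambda>z. cis t * z) \<in> disk_area \<rightarrow>\<^sub>M disk_area"
    unfolding measurable_cong_sets[OF sets_disk_area sets_disk_area]
    by (intro measurable_restrict_space3) (auto simp: norm_mult)
  have "(\<integral>\<^sup>+z. f (cis t * z) \<partial>disk_area)
      = ennreal (1/pi) * (\<integral>\<^sup>+z. f (cis t * z) * indicator (ball 0 1) z \<partial>lborel)"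
    using measurable_compose[OF rot f] by (rule nn_integral_disk_area)
  also have "(\<integral>\<^sup>+z. f (cis t * z) * indicator (ball 0 1) z \<partial>lborel)
      = (\<integral>\<^sup>+z. f (cis t * z) * indicator (ball 0 1) (cis t * z) \<partial>lborel)"
    by (simp add: indicator_def norm_mult)
  also have "\<dots> = (\<integral>\<^sup>+z. f z * indicator (ball 0 1) z \<partial>distr lborel borel (\<lambda>z. cis t * z))"
    by (subst nn_integral_distr) auto
  also have "ennreal (1/pi) * \<dots> = (\<integral>\<^sup>+z. f z \<partial>disk_area)"
    by (simp only: distr_lborel_cis_mult nn_integral_disk_area[OF f])
  finally show ?thesis .
qed

lemma emeasure_disk_area_ball:
  assumes "0 \<le> r" "r \<le> 1"
  shows "emeasure disk_area (ball 0 r) = ennreal (r\<^sup>2)"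
proof -
  have "emeasure disk_area (ball 0 r) = ennreal (1/pi) * emeasure lborel (ball (0::complex) r)"
    using assms by (simp add: disk_area_def emeasure_restrict_space subset_ball)
  also have "\<dots> = ennreal (1/pi) * ennreal (pi * r\<^sup>2)"
    using assms by (simp add: emeasure_ball unit_ball_vol_2 DIM_complex)
  also have "\<dots> = ennreal (r\<^sup>2)"
    by (subst ennreal_mult[symmetric]) auto
  finally show ?thesis .
qed

subsection \<open>Parseval's identity on the circle\<close>

lemma set_integral_cis:
  "(LINT t:{0..2*pi}|lborel. cis (of_int n * t)) = (if n = 0 then 2 * pi else 0)"
proof (cases "n = 0")
  case True
  then show ?thesis
    by (simp add: set_lebesgue_integral_def scaleR_conv_of_real)
next
  case False
  let ?F = "\<lambda>t. cis (of_int n * t) / (\<i> * of_int n)"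
  have deriv: "(?F has_vector_derivative cis (of_int n * t)) (at t within {0..2*pi})" for t
    using False by (auto intro!: derivative_eq_intros simp: has_vector_derivative_def scaleR_conv_of_real fun_eq_iff
      field_simps)
  have "(LINT t:{0..2*pi}|lborel. cis (of_int n * t)) = ?F (2*pi) - ?F 0"
    unfolding set_lebesgue_integral_def
    by (intro integral_FTC_Icc deriv continuous_intros) auto
  also have "cis (of_int n * (2*pi)) = 1"
    using cis_multiple_2pi[of "of_int n"] by (simp add: mult_ac)
  finally show ?thesis
    using False by simp
qed

lemma set_integrable_Icc_continuous:
  fixes f :: "real \<Rightarrow> 'a::{banach, second_countable_topology}"
  assumes "continuous_on UNIV f"
  shows "set_integrable lborel {a..b} f"
  using assms by (intro borel_integrable_atLeastAtMost')(auto intro: continuous_on_subset)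

text \<open>Expanding the square gives a double sum of exponentials, of which only the diagonal has
  a nonzero integral.\<close>

lemma parseval_trig_polynomial:
  assumes "finite S"
  shows "(LINT t:{0..2*pi}|lborel. (norm (\<Sum>n\<in>S. c n * cis (of_int n * t)))\<^sup>2)
    = 2 * pi * (\<Sum>n\<in>S. (norm (c n))\<^sup>2)"
proof -
  have eq: "complex_of_real ((norm (\<Sum>n\<in>S. c n * cis (of_int n * t)))\<^sup>2) =
     (\<Sum>n\<in>S. \<Sum>m\<in>S. c n * cnj (c m) * cis (of_int (n - m) * t))" for t
    unfolding complex_norm_square by (simp add: sum_product cis_cnj cis_mult algebra_simps)
  have int: "set_integrable lborel {0..2*pi} (\<lambda>t. c n * cnj (c m) * cis (of_int (n - m) * t))" for n m
    by (intro set_integrable_Icc_continuous continuous_intros)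
  have "complex_of_real (LINT t:{0..2*pi}|lborel. (norm (\<Sum>n\<in>S. c n * cis (of_int n * t)))\<^sup>2)
     = (LINT t:{0..2*pi}|lborel. complex_of_real ((norm (\<Sum>n\<in>S. c n * cis (of_int n * t)))\<^sup>2))"
    by (rule set_integral_complex_of_real[symmetric])
  also have "\<dots> = (\<Sum>n\<in>S. \<Sum>m\<in>S. LINT t:{0..2*pi}|lborel. c n * cnj (c m) * cis (of_int (n - m) * t))"
    unfolding eq set_lebesgue_integral_def scaleR_sum_right
    using int[unfolded set_integrable_def] by (simp only: Bochner_Integration.integral_sum Bochner_Integration.integrable_sum)
  also have "\<dots> = (\<Sum>n\<in>S. \<Sum>m\<in>S. if m = n then 2 * pi * (c n * cnj (c n)) else 0)"
    by (intro sum.cong refl) (simp only: set_integral_mult_right set_integral_cis, simp)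
  also have "\<dots> = complex_of_real (2 * pi * (\<Sum>n\<in>S. (norm (c n))\<^sup>2))"
    using assms by (simp add: complex_norm_square[symmetric] sum_distrib_left)
  finally show ?thesis
    by (rule of_real_eq_iff[THEN iffD1])
qed

text \<open>Absolute summability bounds all partial sums by one constant, so dominated convergence
  extends the identity from trigonometric polynomials to the series.\<close>

lemma parseval_power_series:
  assumes a: "summable (\<lambda>k. norm (a k :: complex))"
  shows "(\<integral>\<^sup>+t. ennreal ((norm (\<Sum>k. a k * cis (of_nat k * t)))\<^sup>2) * indicator {0..2*pi} t \<partial>lborel)
    = ennreal (2 * pi) * (\<Sum>k. ennreal ((norm (a k))\<^sup>2))"
proof -
  let ?s = "\<lambda>N t. \<Sum>k<N. a k * cis (of_nat k * t)"
  let ?B = "(\<Sum>k. norm (a k))\<^sup>2"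
  have s_bound: "(norm (?s N t))\<^sup>2 \<le> ?B" for N t
  proof (rule power_mono)
    have "norm (?s N t) \<le> (\<Sum>k<N. norm (a k))"
      by (rule order_trans[OF norm_sum]) (simp add: norm_mult)
    also have "\<dots> \<le> (\<Sum>k. norm (a k))"
      using a by (intro sum_le_suminf) auto
    finally show "norm (?s N t) \<le> (\<Sum>k. norm (a k))" .
  qed simp
  have lim: "(\<lambda>N. ?s N t) \<longlonglongrightarrow> (\<Sum>k. a k * cis (of_nat k * t))" for t
  proof (rule summable_LIMSEQ)
    show "summable (\<lambda>k. a k * cis (of_nat k * t))"
      by (rule summable_norm_cancel) (simp add: norm_mult a)
  qed
  have [measurable]: "(\<lambda>t. ?s N t) \<in> borel_measurable borel" for N
    by (intro borel_measurable_continuous_onI continuous_intros)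
  have [measurable]: "(\<lambda>t. \<Sum>k. a k * cis (of_nat k * t)) \<in> borel_measurable borel"
    by (rule borel_measurable_LIMSEQ_metric[OF _ lim]) measurable
  have fin: "(\<integral>\<^sup>+t. ennreal ((norm (?s N t))\<^sup>2) * indicator {0..2*pi} t \<partial>lborel)
     = ennreal (2 * pi) * (\<Sum>k<N. ennreal ((norm (a k))\<^sup>2))" for N
  proof -
    have "(\<integral>\<^sup>+t. ennreal ((norm (?s N t))\<^sup>2) * indicator {0..2*pi} t \<partial>lborel)
        = (\<integral>\<^sup>+t. ennreal (indicator {0..2*pi} t *\<^sub>R (norm (?s N t))\<^sup>2) \<partial>lborel)"
      by (intro nn_integral_cong) (simp split: split_indicator)
    also have "\<dots> = ennreal (LINT t:{0..2*pi}|lborel. (norm (?s N t))\<^sup>2)"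
      unfolding set_lebesgue_integral_def
      by (intro nn_integral_eq_integral set_integrable_Icc_continuous[unfolded set_integrable_def] continuous_intros)
        auto
    also have "(LINT t:{0..2*pi}|lborel. (norm (?s N t))\<^sup>2)
        = (LINT t:{0..2*pi}|lborel. (norm (\<Sum>n\<in>int ` {..<N}. a (nat n) * cis (of_int n * t)))\<^sup>2)"
      by (simp add: sum.reindex)
    also have "\<dots> = 2 * pi * (\<Sum>k<N. (norm (a k))\<^sup>2)"
      by (subst parseval_trig_polynomial) (simp_all add: sum.reindex)
    finally show ?thesis
      by (simp add: ennreal_mult sum_nonneg)
  qed
  have "(\<lambda>N. \<integral>\<^sup>+t. ennreal ((norm (?s N t))\<^sup>2) * indicator {0..2*pi} t \<partial>lborel) \<longlonglongrightarrow>
    (\<integral>\<^sup>+t. ennreal ((norm (\<Sum>k. a k * cis (of_nat k * t)))\<^sup>2) * indicator {0..2*pi} t \<partial>lborel)"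
  proof (rule nn_integral_dominated_convergence[where w = "\<lambda>t. ennreal ?B * indicator {0..2*pi} t"])
    show "(\<integral>\<^sup>+t. ennreal ?B * indicator {0..2*pi} t \<partial>lborel) < \<infinity>"
      by (simp add: nn_integral_cmult_indicator ennreal_mult_less_top)
    show "AE t in lborel. (\<lambda>N. ennreal ((norm (?s N t))\<^sup>2) * indicator {0..2*pi} t)
       \<longlonglongrightarrow> ennreal ((norm (\<Sum>k. a k * cis (of_nat k * t)))\<^sup>2) * indicator {0..2*pi} t"
      by (intro AE_I2) (auto split: split_indicator intro!: tendsto_intros tendsto_ennrealI lim)
    show "AE t in lborel. ennreal ((norm (?s N t))\<^sup>2) * indicator {0..2*pi} t
       \<le> ennreal ?B * indicator {0..2*pi} t" for N
      using s_bound by (auto split: split_indicator intro!: ennreal_leI)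
  qed measurable
  moreover have "(\<lambda>N. ennreal (2 * pi) * (\<Sum>k<N. ennreal ((norm (a k))\<^sup>2)))
     \<longlonglongrightarrow> ennreal (2 * pi) * (\<Sum>k. ennreal ((norm (a k))\<^sup>2))"
    by (intro ennreal_tendsto_cmult summable_LIMSEQ) auto
  ultimately show ?thesis
    unfolding fin by (rule LIMSEQ_unique)
qed

subsection \<open>Area integrals of power series\<close>

interpretation disk_area: finite_measure disk_area
proof
  show "emeasure disk_area (space disk_area) \<noteq> \<infinity>"
    using emeasure_disk_area_ball[of 1] by simp
qed

lemma measurable_disk_area_ident [measurable]: "(\<lambda>z. z) \<in> disk_area \<rightarrow>\<^sub>M borel"
  unfolding measurable_cong_sets[OF sets_disk_area refl]
  by (rule measurable_restrict_space1) simp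

lemma emeasure_disk_area_annulus:
  assumes "0 \<le> r" "r \<le> 1"
  shows "emeasure disk_area {z\<in>ball 0 1. r \<le> norm z} = ennreal (1 - r\<^sup>2)"
proof -
  have sets: "ball 0 s \<in> sets disk_area" if "s \<le> 1" for s
    using that unfolding sets_disk_area by (auto simp: sets_restrict_space_iff subset_ball)
  have "{z\<in>ball (0::complex) 1. r \<le> norm z} = ball 0 1 - ball 0 r"
    by auto
  then have "emeasure disk_area {z\<in>ball 0 1. r \<le> norm z} = emeasure disk_area (ball 0 1 - ball 0 r)"
    by simp
  also have "\<dots> = emeasure disk_area (ball 0 1) - emeasure disk_area (ball 0 r)"
    using assms sets by (intro emeasure_Diff) (auto simp: subset_ball)
  also have "\<dots> = ennreal (1 - r\<^sup>2)"
    using assms emeasure_disk_area_ball[of 1] emeasure_disk_area_ball[of r]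
    by (simp flip: ennreal_1 add: ennreal_minus)
  finally show ?thesis .
qed

text \<open>A layer-cake computation: \<open>norm z ^ (2 * k)\<close> is the integral of the
  derivative \<open>\<phi>\<close> from \<open>0\<close> to \<open>norm z\<close>, and exchanging
  the integrals leaves the annulus areas \<open>1 - s^2\<close>. For \<open>k = 0\<close> the
  density \<open>\<phi>\<close> is zero while the integrand is \<open>1\<close>, so that case is
  separate.\<close>

lemma nn_integral_disk_area_power:
  "(\<integral>\<^sup>+z. ennreal (norm z ^ (2 * k)) \<partial>disk_area) = ennreal (1 / (real k + 1))"
proof (cases "k = 0")
  case True
  then show ?thesis
    using emeasure_disk_area_ball[of 1] by simp
next
  case False
  interpret pair_sigma_finite lborel disk_area
    by unfold_locales
  define \<phi> where "\<phi> = (\<lambda>s::real. 2 * real k * s ^ (2 * k - 1))"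
  have [measurable]: "\<phi> \<in> borel_measurable borel"
    unfolding \<phi>_def by measurable
  have \<phi>_nonneg: "0 \<le> \<phi> s" if "0 \<le> s" for s
    using that by (simp add: \<phi>_def)
  have layer: "ennreal (r ^ (2 * k)) = (\<integral>\<^sup>+s. ennreal (\<phi> s) * indicator {0..r} s \<partial>lborel)" if "0 \<le> r" for r :: real
  proof -
    have "(\<integral>\<^sup>+s. ennreal (\<phi> s) * indicator {0..r} s \<partial>lborel) = ennreal (r ^ (2 * k) - 0 ^ (2 * k))"
      using that \<phi>_nonneg
      by (intro nn_integral_FTC_Icc[where F = "\<lambda>s. s ^ (2 * k)"]) (auto simp: \<phi>_def intro!: derivative_eq_intros)
    then show ?thesis
      using False by (simp add: power_0_left)
  qed
  have "(\<integral>\<^sup>+z. ennreal (norm z ^ (2 * k)) \<partial>disk_area)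
     = (\<integral>\<^sup>+z. \<integral>\<^sup>+s. ennreal (\<phi> s) * indicator {0..1} s * indicator {p. snd p \<le> norm (fst p)} (z, s) \<partial>lborel \<partial>disk_area)"
    by (intro nn_integral_cong) (auto simp: layer split: split_indicator intro!: nn_integral_cong)
  also have "\<dots> = (\<integral>\<^sup>+s. \<integral>\<^sup>+z. ennreal (\<phi> s) * indicator {0..1} s * indicator {p. snd p \<le> norm (fst p)} (z, s) \<partial>disk_area \<partial>lborel)"
    by (rule Fubini') measurable
  also have "\<dots> = (\<integral>\<^sup>+s. ennreal (\<phi> s * (1 - s\<^sup>2)) * indicator {0..1} s \<partial>lborel)"
  proof (rule nn_integral_cong)
    fix s :: real
    have "(\<integral>\<^sup>+z. indicator {p. snd p \<le> norm (fst p)} (z, s) \<partial>disk_area) = ennreal (1 - s\<^sup>2)" if "0 \<le> s" "s \<le> 1"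
    proof -
      have "(\<integral>\<^sup>+z. indicator {p. snd p \<le> norm (fst p)} (z, s) \<partial>disk_area)
         = (\<integral>\<^sup>+z. indicator {z\<in>ball 0 1. s \<le> norm z} z \<partial>disk_area)"
        by (intro nn_integral_cong) (auto split: split_indicator)
      also have "\<dots> = emeasure disk_area {z\<in>ball 0 1. s \<le> norm z}"
      proof (rule nn_integral_indicator)
        have "{z\<in>space disk_area. s \<le> norm z} \<in> sets disk_area"
          by measurable
        then show "{z\<in>ball 0 1. s \<le> norm z} \<in> sets disk_area"
          by simp
      qed
      finally show ?thesis
        using emeasure_disk_area_annulus[OF that] by simp
    qed
    then show "(\<integral>\<^sup>+z. ennreal (\<phi> s) * indicator {0..1} s * indicator {p. snd p \<le> norm (fst p)} (z, s) \<partial>disk_area)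
       = ennreal (\<phi> s * (1 - s\<^sup>2)) * indicator {0..1} s"
      by (subst nn_integral_cmult) (auto split: split_indicator simp: \<phi>_nonneg ennreal_mult power_le_one)
  qed
  also have "\<dots> = ennreal ((1 ^ (2 * k) - real k / (real k + 1) * 1 ^ (2 * k + 2))
       - (0 ^ (2 * k) - real k / (real k + 1) * 0 ^ (2 * k + 2)))"
  \<comment> \<open>This \<open>F\<close> is the termwise antiderivative of
    \<open>2 k s^(2k-1) - 2 k s^(2k+1)\<close>; its value at \<open>1\<close> is
    \<open>1 - k/(k+1) = 1/(k+1)\<close>.\<close>
  proof (rule nn_integral_FTC_Icc[where F = "\<lambda>s. s ^ (2 * k) - real k / (real k + 1) * s ^ (2 * k + 2)"])
    fix s :: real
    assume "s \<in> {0..1}"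
    then show "0 \<le> \<phi> s * (1 - s\<^sup>2)"
      by (simp add: \<phi>_nonneg power_le_one)
    have "s ^ (2 * k - 1) * s\<^sup>2 = s ^ (2 * k + 1)"
      using False by (simp flip: power_add)
    then have eq: "\<phi> s * (1 - s\<^sup>2) = 2 * real k * s ^ (2 * k - 1) - 2 * real k * s ^ (2 * k + 1)"
      by (simp add: \<phi>_def algebra_simps)
    have "real k / (real k + 1) * (real (2 * k + 2) * s ^ (2 * k + 1)) = 2 * real k * s ^ (2 * k + 1)"
      by (simp add: field_simps)
    moreover have "((\<lambda>s. s ^ (2 * k) - real k / (real k + 1) * s ^ (2 * k + 2)) has_real_derivative
        real (2 * k) * s ^ (2 * k - Suc 0)
        - real k / (real k + 1) * (real (2 * k + 2) * s ^ (2 * k + 2 - Suc 0))) (at s)"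
      by (intro DERIV_diff DERIV_cmult DERIV_pow)
    ultimately show "((\<lambda>s. s ^ (2 * k) - real k / (real k + 1) * s ^ (2 * k + 2))
        has_real_derivative \<phi> s * (1 - s\<^sup>2)) (at s)"
      unfolding eq by simp
  qed auto
  also have "\<dots> = ennreal (1 / (real k + 1))"
    using False by (simp add: field_simps power_0_left)
  finally show ?thesis .
qed

text \<open>Rotation invariance lets each point be averaged over its circle, where Parseval removes
  the cross terms; integrating the powers of \<open>norm z\<close> then gives the weights
  \<open>1 / (k + 1)\<close>.\<close>

lemma nn_integral_disk_area_power_series:
  assumes sums: "\<And>z. norm z < 1 \<Longrightarrow> (\<lambda>k. b k * z ^ k) sums g z"
    and [measurable]: "g \<in> borel_measurable disk_area"
  shows "(\<integral>\<^sup>+z. ennreal ((norm (g z))\<^sup>2) \<partial>disk_area) = (\<Sum>k. ennreal ((norm (b k))\<^sup>2 / (real k + 1)))"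
proof -
  interpret pair_sigma_finite lborel disk_area
    by unfold_locales
  let ?h = "\<lambda>z. ennreal ((norm (g z))\<^sup>2)"
  have rot: "(\<lambda>(t, z). cis t * z) \<in> lborel \<Otimes>\<^sub>M disk_area \<rightarrow>\<^sub>M disk_area"
  proof -
    have [measurable]: "cis \<in> borel_measurable borel"
      by (intro borel_measurable_continuous_onI continuous_intros)
    have "(\<lambda>(t, z). cis t * z) \<in> lborel \<Otimes>\<^sub>M disk_area \<rightarrow>\<^sub>M restrict_space borel (ball 0 1)"
      by (rule measurable_restrict_space2) (auto simp: space_pair_measure norm_mult)
    then show ?thesis
      by (simp add: measurable_cong_sets[OF refl sets_disk_area])
  qed
  have meas: "(\<lambda>(t, z). ?h (cis t * z) * indicator {0..2*pi} t) \<in> borel_measurable (lborel \<Otimes>\<^sub>M disk_area)"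
  proof -
    have [measurable]: "(\<lambda>p. g (cis (fst p) * snd p)) \<in> borel_measurable (lborel \<Otimes>\<^sub>M disk_area)"
      using measurable_compose[OF rot assms(2)] by (simp add: case_prod_beta)
    show ?thesis
      unfolding case_prod_beta by measurable
  qed
  \<comment> \<open>The factor \<open>2 * pi\<close> is the length of the interval of angles; it is
    cancelled at the end.\<close>
  have "ennreal (2 * pi) * (\<integral>\<^sup>+z. ?h z \<partial>disk_area)
      = (\<integral>\<^sup>+t. (\<integral>\<^sup>+z. ?h z \<partial>disk_area) * indicator {0..2*pi} t \<partial>lborel)"
    by (subst nn_integral_cmult_indicator) (auto simp: mult.commute)
  also have "\<dots> = (\<integral>\<^sup>+t. (\<integral>\<^sup>+z. ?h (cis t * z) * indicator {0..2*pi} t \<partial>disk_area) \<partial>lborel)"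
  proof (rule nn_integral_cong)
    fix t :: real
    show "(\<integral>\<^sup>+z. ?h z \<partial>disk_area) * indicator {0..2*pi} t
        = (\<integral>\<^sup>+z. ?h (cis t * z) * indicator {0..2*pi} t \<partial>disk_area)"
      using nn_integral_disk_area_rotate[of ?h t] by (simp split: split_indicator)
  qed
  also have "\<dots> = (\<integral>\<^sup>+z. (\<integral>\<^sup>+t. ?h (cis t * z) * indicator {0..2*pi} t \<partial>lborel) \<partial>disk_area)"
    using meas by (rule Fubini'[symmetric])
  also have "\<dots> = (\<integral>\<^sup>+z. ennreal (2 * pi) * (\<Sum>k. ennreal ((norm (b k))\<^sup>2) * ennreal (norm z ^ (2 * k))) \<partial>disk_area)"
  proof (rule nn_integral_cong)
    fix z :: complex
    assume "z \<in> space disk_area"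
    then have z: "norm z < 1"
      by simp
    \<comment> \<open>Parseval needs absolute convergence on the circle through \<open>z\<close>;
      convergence at the larger radius \<open>r\<close> provides it.\<close>
    obtain r where r: "norm z < r" "r < 1"
      using dense[OF z] by blast
    have "summable (\<lambda>k. norm (b k * z ^ k))"
    proof (rule powser_insidea)
      have "\<bar>r\<bar> = r"
        using r norm_ge_zero[of z] by linarith
      with r show "norm z < norm (complex_of_real r)" "summable (\<lambda>k. b k * of_real r ^ k)"
        by (auto intro!: sums_summable[OF sums])
    qed
    note * = parseval_power_series[OF this]
    have "g (cis t * z) = (\<Sum>k. b k * z ^ k * cis (of_nat k * t))" for t
      using sums[of "cis t * z"] z
      by (simp add: norm_mult sums_iff power_mult_distrib Complex.DeMoivre mult_ac)
    then have "(\<integral>\<^sup>+t. ?h (cis t * z) * indicator {0..2*pi} t \<partial>lborel)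
       = ennreal (2 * pi) * (\<Sum>k. ennreal ((norm (b k * z ^ k))\<^sup>2))"
      using * by simp
    also have "(\<lambda>k. ennreal ((norm (b k * z ^ k))\<^sup>2)) = (\<lambda>k. ennreal ((norm (b k))\<^sup>2) * ennreal (norm z ^ (2 * k)))"
      by (auto simp: norm_mult norm_power power_mult_distrib power_even_eq simp flip: ennreal_mult)
    finally show "(\<integral>\<^sup>+t. ?h (cis t * z) * indicator {0..2*pi} t \<partial>lborel)
       = ennreal (2 * pi) * (\<Sum>k. ennreal ((norm (b k))\<^sup>2) * ennreal (norm z ^ (2 * k)))" .
  qed
  also have "\<dots> = ennreal (2 * pi) * (\<Sum>k. ennreal ((norm (b k))\<^sup>2) * (\<integral>\<^sup>+z. ennreal (norm z ^ (2 * k)) \<partial>disk_area))"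
    by (simp add: nn_integral_cmult nn_integral_suminf)
  finally have "(\<integral>\<^sup>+z. ?h z \<partial>disk_area)
      = (\<Sum>k. ennreal ((norm (b k))\<^sup>2) * (\<integral>\<^sup>+z. ennreal (norm z ^ (2 * k)) \<partial>disk_area))"
    by (subst (asm) ennreal_mult_cancel_left) auto
  also have "\<dots> = (\<Sum>k. ennreal ((norm (b k))\<^sup>2 / (real k + 1)))"
    unfolding nn_integral_disk_area_power by (simp flip: ennreal_mult)
  finally show ?thesis .
qed

subsection \<open>The Dirichlet space in terms of Taylor coefficients\<close>

lemma taylor_coeff_sums:
  assumes "f holomorphic_on ball 0 1" "norm z < 1"
  shows "(\<lambda>k. taylor_coeff f k * z ^ k) sums f z"
  using holomorphic_power_series[of f 0 1 z] assms by (simp add: taylor_coeff_def)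

lemma taylor_coeff_deriv: "taylor_coeff (deriv f) k = (of_nat k + 1) * taylor_coeff f (Suc k)"
proof -
  have "(of_nat k + 1) * (D / ((of_nat k + 1) * fact k)) = D / (fact k :: complex)" for D
    using of_nat_neq_0[of k, where 'a = complex] by (simp add: add_ac)
  then show ?thesis
    by (simp add: taylor_coeff_def funpow_swap1 add_ac)
qed

lemma power_series_holomorphic_ball:
  assumes "\<And>z. norm z < 1 \<Longrightarrow> (\<lambda>k. a k * z ^ k) sums f z"
  shows "f holomorphic_on ball 0 1"
  using assms by (intro power_series_holomorphic[of 0 1 a]) auto

lemma taylor_coeff_power_series:
  assumes "\<And>z. norm z < 1 \<Longrightarrow> (\<lambda>k. a k * z ^ k) sums f z"
  shows "taylor_coeff f = a"
proof
  fix k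
  have "f has_fps_expansion Abs_fps a"
  proof (rule has_fps_expansionI)
    have "eventually (\<lambda>u::complex. u \<in> ball 0 1) (nhds 0)"
      by (intro eventually_nhds_in_open) auto
    then show "eventually (\<lambda>u. (\<lambda>n. fps_nth (Abs_fps a) n * u ^ n) sums f u) (nhds 0)"
      by eventually_elim (use assms in auto)
  qed
  from fps_nth_fps_expansion[OF this, of k] show "taylor_coeff f k = a k"
    by (simp add: taylor_coeff_def)
qed

lemma borel_measurable_deriv_disk_area:
  assumes f: "f holomorphic_on ball 0 1"
  shows "deriv f \<in> borel_measurable disk_area"
  unfolding measurable_cong_sets[OF sets_disk_area refl]
  using f by (intro borel_measurable_continuous_on_restrict holomorphic_on_imp_continuous_on holomorphic_deriv) auto

text \<open>Differentiation brings a factor \<open>k + 1\<close>, squared by the norm, and the area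
  integral divides by \<open>k + 1\<close>; this leaves weight \<open>k + 1\<close> on coefficient
  \<open>k + 1\<close>. Shifting the index adds only a zero term.\<close>

lemma nn_integral_norm_deriv_sq:
  assumes f: "f holomorphic_on ball 0 1"
  shows "(\<integral>\<^sup>+z. ennreal ((norm (deriv f z))\<^sup>2) \<partial>disk_area)
    = (\<Sum>k. ennreal (real k * (norm (taylor_coeff f k))\<^sup>2))"
proof -
  have holo: "deriv f holomorphic_on ball 0 1"
    using f by (intro holomorphic_deriv) auto
  have eq: "(norm (taylor_coeff (deriv f) k))\<^sup>2 / (real k + 1) = real (Suc k) * (norm (taylor_coeff f (Suc k)))\<^sup>2" for k
  proof -
    have "norm (of_nat k + 1 :: complex) = real k + 1"
      by (metis norm_of_nat of_nat_Suc add.commute)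
    then show ?thesis
      by (simp add: taylor_coeff_deriv norm_mult power_mult_distrib power2_eq_square add_ac)
  qed
  have "(\<integral>\<^sup>+z. ennreal ((norm (deriv f z))\<^sup>2) \<partial>disk_area)
      = (\<Sum>k. ennreal ((norm (taylor_coeff (deriv f) k))\<^sup>2 / (real k + 1)))"
    by (intro nn_integral_disk_area_power_series taylor_coeff_sums borel_measurable_deriv_disk_area holo f)
  also have "\<dots> = (\<Sum>k. ennreal (real (Suc k) * (norm (taylor_coeff f (Suc k)))\<^sup>2))"
    by (simp only: eq)
  also have "\<dots> = (\<Sum>k. ennreal (real k * (norm (taylor_coeff f k))\<^sup>2))"
    by (subst suminf_offset[of _ 1]) (simp_all del: of_nat_Suc)
  finally show ?thesis .
qed

text \<open>For \<open>k >= 1\<close> the weights satisfy \<open>k <= k + 1 <= 2 * k\<close>, and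
  one term does not affect convergence.\<close>

lemma summable_real_nat_weight_iff:
  fixes f :: "nat \<Rightarrow> real"
  assumes "\<And>k. 0 \<le> f k"
  shows "summable (\<lambda>k. real k * f k) \<longleftrightarrow> summable (\<lambda>k. (real k + 1) * f k)"
proof
  assume *: "summable (\<lambda>k. real k * f k)"
  have "summable (\<lambda>k. 2 * (real k * f k))"
    using * by (rule summable_mult)
  moreover have "norm ((real k + 1) * f k) \<le> 2 * (real k * f k)" if "k \<ge> 1" for k
  proof -
    have "(real k + 1) * f k \<le> (2 * real k) * f k"
      using that assms by (intro mult_right_mono) auto
    then show ?thesis
      using assms[of k] by (simp add: mult_ac)
  qed
  ultimately show "summable (\<lambda>k. (real k + 1) * f k)"
    by (rule summable_comparison_test')
next
  assume "summable (\<lambda>k. (real k + 1) * f k)"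
  then show "summable (\<lambda>k. real k * f k)"
    by (rule summable_comparison_test') (use assms in \<open>auto simp: mult_right_mono\<close>)
qed

text \<open>The area integral yields the weight \<open>k\<close>; passing to \<open>k + 1\<close>
  does not change summability and makes the sum control the constant coefficient too.\<close>

lemma Dirichlet_space_iff_summable:
  "f \<in> Dirichlet_space \<longleftrightarrow> f holomorphic_on ball 0 1 \<and> summable (\<lambda>k. (real k + 1) * (norm (taylor_coeff f k))\<^sup>2)"
proof (cases "f holomorphic_on ball 0 1")
  case True
  note [measurable] = borel_measurable_deriv_disk_area[OF True]
  have "f \<in> Dirichlet_space \<longleftrightarrow> (\<Sum>k. ennreal (real k * (norm (taylor_coeff f k))\<^sup>2)) < \<infinity>"
    using True by (simp add: Dirichlet_space_def integrable_iff_bounded flip: nn_integral_norm_deriv_sq)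
  also have "\<dots> \<longleftrightarrow> summable (\<lambda>k. real k * (norm (taylor_coeff f k))\<^sup>2)"
  proof
    assume "(\<Sum>k. ennreal (real k * (norm (taylor_coeff f k))\<^sup>2)) < \<infinity>"
    then show "summable (\<lambda>k. real k * (norm (taylor_coeff f k))\<^sup>2)"
      by (intro summable_suminf_not_top) auto
  next
    assume "summable (\<lambda>k. real k * (norm (taylor_coeff f k))\<^sup>2)"
    then show "(\<Sum>k. ennreal (real k * (norm (taylor_coeff f k))\<^sup>2)) < \<infinity>"
      by (subst suminf_ennreal2) auto
  qed
  also have "\<dots> \<longleftrightarrow> summable (\<lambda>k. (real k + 1) * (norm (taylor_coeff f k))\<^sup>2)"
    by (intro summable_real_nat_weight_iff) auto
  finally show ?thesis
    using True by simp
qed (simp add: Dirichlet_space_def)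

lemma Dirichlet_norm_sq:
  assumes f: "f \<in> Dirichlet_space"
  shows "(Dirichlet_norm f)\<^sup>2 = (norm (taylor_coeff f 0))\<^sup>2 + (\<Sum>k. real k * (norm (taylor_coeff f k))\<^sup>2)"
proof -
  have holo: "f holomorphic_on ball 0 1" and int: "integrable disk_area (\<lambda>z. (norm (deriv f z))\<^sup>2)"
    using f by (auto simp: Dirichlet_space_def)
  have summ: "summable (\<lambda>k. real k * (norm (taylor_coeff f k))\<^sup>2)"
    using f by (simp add: Dirichlet_space_iff_summable summable_real_nat_weight_iff)
  have "ennreal (LINT z|disk_area. (norm (deriv f z))\<^sup>2) = (\<Sum>k. ennreal (real k * (norm (taylor_coeff f k))\<^sup>2))"
    using int by (simp flip: nn_integral_norm_deriv_sq[OF holo] add: nn_integral_eq_integral)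
  also have "\<dots> = ennreal (\<Sum>k. real k * (norm (taylor_coeff f k))\<^sup>2)"
    using summ by (intro suminf_ennreal2) auto
  finally have "(LINT z|disk_area. (norm (deriv f z))\<^sup>2) = (\<Sum>k. real k * (norm (taylor_coeff f k))\<^sup>2)"
    using summ by (subst (asm) ennreal_inj) (auto intro!: suminf_nonneg)
  moreover have "0 \<le> (\<Sum>k. real k * (norm (taylor_coeff f k))\<^sup>2)"
    using summ by (intro suminf_nonneg) auto
  ultimately show ?thesis
    by (simp add: Dirichlet_norm_def taylor_coeff_def)
qed

lemma Dirichlet_norm_nonneg: "0 \<le> Dirichlet_norm f"
  by (simp add: Dirichlet_norm_def)

text \<open>The squared norm puts weight \<open>1\<close> on coefficient \<open>0\<close> and weight
  \<open>k\<close> on coefficient \<open>k >= 1\<close>, which differs from \<open>k + 1\<close> by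
  at most a factor \<open>2\<close>.\<close>

lemma
  assumes f: "f \<in> Dirichlet_space"
  shows Dirichlet_norm_sq_le: "(Dirichlet_norm f)\<^sup>2 \<le> (\<Sum>k. (real k + 1) * (norm (taylor_coeff f k))\<^sup>2)"
    and Dirichlet_norm_sq_ge: "(\<Sum>k. (real k + 1) * (norm (taylor_coeff f k))\<^sup>2) \<le> 2 * (Dirichlet_norm f)\<^sup>2"
proof -
  let ?a = "\<lambda>k. (norm (taylor_coeff f k))\<^sup>2"
  have summ: "summable (\<lambda>k. (real k + 1) * ?a k)"
    using f by (simp add: Dirichlet_space_iff_summable)
  then have summ': "summable (\<lambda>k. real k * ?a k)"
    by (simp add: summable_real_nat_weight_iff)
  have summ0: "summable ?a"
    using summable_diff[OF summ summ'] by (simp add: algebra_simps)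
  have split: "(\<Sum>k. (real k + 1) * ?a k) = (\<Sum>k. real k * ?a k) + (\<Sum>k. ?a k)"
    using suminf_add[OF summ' summ0] by (simp add: algebra_simps)
  have head: "(\<Sum>k. ?a k) = ?a 0 + (\<Sum>k. ?a (Suc k))"
    using suminf_split_head[OF summ0] by simp
  have tail: "(\<Sum>k. real k * ?a k) = (\<Sum>k. real (Suc k) * ?a (Suc k))"
    using suminf_split_head[OF summ'] by simp
  have "(\<Sum>k. ?a (Suc k)) \<le> (\<Sum>k. real (Suc k) * ?a (Suc k))"
    by (intro suminf_le summ0[THEN summable_ignore_initial_segment[where k = 1], simplified]
        summ'[THEN summable_ignore_initial_segment[where k = 1], unfolded Suc_eq_plus1[symmetric]])
      (auto simp: mult_le_cancel_right1 simp del: of_nat_Suc)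
  then have le: "(\<Sum>k. ?a (Suc k)) \<le> (\<Sum>k. real k * ?a k)"
    by (simp only: tail)
  have nonneg: "0 \<le> (\<Sum>k. ?a (Suc k))"
    by (intro suminf_nonneg summ0[THEN summable_ignore_initial_segment[where k = 1], simplified]) auto
  show "(Dirichlet_norm f)\<^sup>2 \<le> (\<Sum>k. (real k + 1) * ?a k)"
    unfolding Dirichlet_norm_sq[OF f] split head using nonneg by simp
  show "(\<Sum>k. (real k + 1) * ?a k) \<le> 2 * (Dirichlet_norm f)\<^sup>2"
    unfolding Dirichlet_norm_sq[OF f] split head using le
    by (simp add: add_increasing)
qed

lemma summable_power_series_ball:
  fixes a :: "nat \<Rightarrow> complex"
  assumes "summable (\<lambda>k. (real k + 1) * (norm (a k))\<^sup>2)" "norm z < 1"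
  shows "summable (\<lambda>k. norm (a k * z ^ k))"
proof -
  obtain B where B: "\<And>k. (real k + 1) * (norm (a k))\<^sup>2 \<le> B"
    using summable_imp_Bseq[OF assms(1)] unfolding Bseq_def by (metis abs_le_D1 real_norm_def)
  \<comment> \<open>This follows from \<open>norm (a k) ^ 2 <= B\<close> and
    \<open>2 * x <= 1 + x ^ 2\<close>; any uniform bound suffices for comparison with a geometric
    series.\<close>
  have a: "norm (a k) \<le> 1 + B" for k
  proof -
    have "0 \<le> real k * (norm (a k))\<^sup>2"
      by simp
    moreover have "2 * norm (a k) \<le> 1 + (norm (a k))\<^sup>2"
      using zero_le_power2[of "norm (a k) - 1"] by (simp add: power2_eq_square algebra_simps)
    ultimately show ?thesis
      using B[of k] norm_ge_zero[of "a k"] unfolding distrib_right by linarith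
  qed
  have "summable (\<lambda>k. (1 + B) * norm z ^ k)"
    using assms(2) by (intro summable_mult summable_geometric) simp
  then show ?thesis
    by (rule summable_comparison_test') (use a in \<open>auto simp: norm_mult norm_power intro: mult_right_mono\<close>)
qed

lemma Dirichlet_power_series:
  fixes a :: "nat \<Rightarrow> complex"
  assumes a: "summable (\<lambda>k. (real k + 1) * (norm (a k))\<^sup>2)"
    and f: "\<And>z. norm z < 1 \<Longrightarrow> f z = (\<Sum>k. a k * z ^ k)"
  shows "f \<in> Dirichlet_space" "taylor_coeff f = a"
proof -
  have sums: "(\<lambda>k. a k * z ^ k) sums f z" if "norm z < 1" for z
    using summable_norm_cancel[OF summable_power_series_ball[OF a that]] f[OF that]
    by (simp add: summable_sums)
  show "taylor_coeff f = a"
    using sums by (rule taylor_coeff_power_series)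
  then show "f \<in> Dirichlet_space"
    using a power_series_holomorphic_ball[OF sums] by (simp add: Dirichlet_space_iff_summable)
qed

subsection \<open>Density of Lambda(p) sets\<close>

lemma half_le_cos:
  assumes "0 \<le> x" "x \<le> 1"
  shows "1 / 2 \<le> cos (x::real)"
proof -
  have "cos (pi / 3) \<le> cos x"
    using assms pi_gt3 by (intro cos_monotone_0_pi_le) auto
  then show ?thesis
    by (simp add: cos_60)
qed

text \<open>The test polynomial \<open>\<Sum>n\<in>A. z ^ n\<close> has modulus at least \<open>card A / 2\<close> on an arc of length \<open>1 / N\<close>.\<close>

lemma Rudin_Lambda_card_bound:
  assumes p: "p > 2" and Lambda: "Rudin_Lambda p (int ` E)"
  obtains C where "C \<ge> 0"
    "\<And>j N. N \<ge> 1 \<Longrightarrow> real (card (E \<inter> {j..<j + N})) \<le> C * real N powr (2 / p)"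
proof -
  obtain C where C: "\<And>f. trig_polynomial f \<Longrightarrow> (\<And>n. n \<notin> int ` E \<Longrightarrow> fourier_coeff f n = 0)
      \<Longrightarrow> circle_Lp_norm p f \<le> C * circle_Lp_norm 2 f"
    using Lambda unfolding Rudin_Lambda_def by blast
  \<comment> \<open>The constant comes from solving
    \<open>M / 2 <= |C| * sqrt M * (2 * pi * N) powr (1 / p)\<close> for the cardinality
    \<open>M\<close>.\<close>
  have "real (card (E \<inter> {j..<j + N})) \<le> (2 * \<bar>C\<bar> * (2 * pi) powr (1 / p))\<^sup>2 * real N powr (2 / p)"
    if N: "N \<ge> 1" for j N
  proof (cases "E \<inter> {j..<j + N} = {}")
    case False
    define A where "A = E \<inter> {j..<j + N}"
    define f where "f = (\<lambda>z::complex. \<Sum>n\<in>int ` A. 1 * z powi n)"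
    define M where "M = real (card A)"
    have "finite A"
      by (simp add: A_def)
    then have fin: "finite (int ` A)" and M: "M > 0"
      using False by (auto simp: M_def A_def card_gt_0_iff)
    have f_cis: "f (cis t) = (\<Sum>n\<in>int ` A. 1 * cis (of_int n * t))" for t
      by (simp add: f_def cis_power_int)
    have cont: "continuous_on UNIV (\<lambda>t. f (cis t))"
      unfolding f_cis by (intro continuous_intros)
    have trig: "trig_polynomial f"
      unfolding trig_polynomial_def using fin by (intro exI[of _ "int ` A"] exI[of _ "\<lambda>_. 1"]) (auto simp: f_def)
    have coeff: "fourier_coeff f n = 0" if "n \<notin> int ` E" for n
    proof -
      have "f (cis t) * cis (- (of_int n * t)) = (\<Sum>m\<in>int ` A. cis (of_int (m - n) * t))" for t
        unfolding f_cis sum_distrib_right by (intro sum.cong refl) (simp add: cis_mult algebra_simps)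
      moreover have "set_integrable lborel {0..2*pi} (\<lambda>t. cis (of_int (m - n) * t))" for m
        by (intro set_integrable_Icc_continuous continuous_intros)
      ultimately have "(LINT t:{0..2*pi}|lborel. f (cis t) * cis (- (of_int n * t)))
          = (\<Sum>m\<in>int ` A. LINT t:{0..2*pi}|lborel. cis (of_int (m - n) * t))"
        unfolding set_lebesgue_integral_def set_integrable_def
        by (simp only: scaleR_sum_right Bochner_Integration.integral_sum)
      also have "\<dots> = 0"
      proof (rule sum.neutral, rule ballI)
        fix m
        assume "m \<in> int ` A"
        then have "m - n \<noteq> 0"
          using that by (auto simp: A_def)
        then show "(LINT t:{0..2*pi}|lborel. cis (of_int (m - n) * t)) = 0"
          by (subst set_integral_cis) simp
      qed
      finally show ?thesis
        by (simp add: fourier_coeff_def)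
    qed
    have L2: "circle_Lp_norm 2 f = sqrt M"
    proof -
      have "(LINT t:{0..2*pi}|lborel. norm (f (cis t)) powr 2) = 2 * pi * M"
        using parseval_trig_polynomial[OF fin, of "\<lambda>_. 1"] by (simp add: f_cis M_def card_image)
      then show ?thesis
        using M by (simp add: circle_Lp_norm_def powr_half_sqrt)
    qed
    define I where "I = (LINT t:{0..2*pi}|lborel. norm (f (cis t)) powr p)"
    \<comment> \<open>On this arc the shifted frequencies \<open>n - j\<close> are below
      \<open>N\<close>, so every angle lies in \<open>[0, 1]\<close> and has cosine at least
      \<open>1 / 2\<close>.\<close>
    have "M / 2 \<le> norm (f (cis t))" if t: "t \<in> {0..1 / real N}" for t
    proof -
      have "M / 2 = (\<Sum>n\<in>A. 1 / 2)"
        by (simp add: M_def)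
      also have "\<dots> \<le> (\<Sum>n\<in>A. cos (real (n - j) * t))"
      proof (rule sum_mono)
        fix n
        assume "n \<in> A"
        then have "real (n - j) * t \<le> real N * (1 / real N)"
          using t by (intro mult_mono) (auto simp: A_def)
        then show "1 / 2 \<le> cos (real (n - j) * t)"
          using t N by (intro half_le_cos) auto
      qed
      also have "\<dots> = Re (\<Sum>n\<in>A. cis (real (n - j) * t))"
        by simp
      \<comment> \<open>The unimodular factor \<open>cis (- (real j * t))\<close> shifts the
        frequencies down by \<open>j\<close> without changing the modulus.\<close>
      also have "(\<Sum>n\<in>A. cis (real (n - j) * t)) = cis (- (real j * t)) * f (cis t)"
        by (auto simp: f_cis sum.reindex sum_distrib_left cis_mult A_def algebra_simps of_nat_diff intro!: sum.cong)
      also have "Re \<dots> \<le> norm (cis (- (real j * t)) * f (cis t))"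
        by (rule complex_Re_le_cmod)
      finally show ?thesis
        by (simp add: norm_mult)
    qed
    note lower = this
    have "(LINT t:{0..1 / real N}|lborel. (M / 2) powr p) \<le> I"
      unfolding I_def set_lebesgue_integral_def
    proof (rule integral_mono)
      show "integrable lborel (\<lambda>t. indicator {0..1 / real N} t *\<^sub>R (M / 2) powr p)"
        by simp
      have "set_integrable lborel {0..2*pi} (\<lambda>t. norm (f (cis t)) powr p)"
        using p cont by (intro set_integrable_Icc_continuous continuous_on_powr' continuous_intros) auto
      then show "integrable lborel (\<lambda>t. indicator {0..2*pi} t *\<^sub>R norm (f (cis t)) powr p)"
        by (simp add: set_integrable_def)
      have "1 / real N \<le> 1" "1 \<le> 2 * pi"
        using N pi_gt3 by auto
      then have "1 / real N \<le> 2 * pi"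
        by (rule order_trans)
      then show "indicator {0..1 / real N} t *\<^sub>R (M / 2) powr p \<le> indicator {0..2*pi} t *\<^sub>R norm (f (cis t)) powr p" for t
        using lower[of t] M p by (auto split: split_indicator intro: powr_mono2)
    qed
    then have I: "(M / 2) powr p / real N \<le> I"
      by (simp add: set_lebesgue_integral_def)
    have "M / 2 = ((M / 2) powr p / real N / (2 * pi) * (2 * pi * real N)) powr (1 / p)"
      using M N p by (simp add: powr_powr)
    also have "\<dots> = ((M / 2) powr p / real N / (2 * pi)) powr (1 / p) * (2 * pi * real N) powr (1 / p)"
      by (rule powr_mult)
    also have "((M / 2) powr p / real N / (2 * pi)) powr (1 / p) \<le> (I / (2 * pi)) powr (1 / p)"
      using I M N p by (intro powr_mono2 divide_right_mono) auto
    also have "\<dots> = circle_Lp_norm p f"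
      by (simp add: circle_Lp_norm_def I_def)
    also have "\<dots> \<le> C * sqrt M"
      using C[OF trig coeff] by (simp add: L2)
    \<comment> \<open>\<open>Rudin_Lambda\<close> prescribes no sign for \<open>C\<close>.\<close>
    also have "\<dots> \<le> \<bar>C\<bar> * sqrt M"
      using M by (intro mult_right_mono) auto
    finally have "M / 2 \<le> \<bar>C\<bar> * sqrt M * (2 * pi * real N) powr (1 / p)"
      by (simp add: mult_right_mono)
    \<comment> \<open>One factor \<open>sqrt M\<close>, the \<open>L^2\<close> norm of
      \<open>f\<close>, cancels; squaring what remains bounds the cardinality.\<close>
    then have "sqrt M * sqrt M \<le> sqrt M * (2 * \<bar>C\<bar> * (2 * pi * real N) powr (1 / p))"
      using M by (simp add: mult_ac)
    then have "sqrt M \<le> 2 * \<bar>C\<bar> * (2 * pi * real N) powr (1 / p)"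
      by (rule mult_left_le_imp_le) (use M in simp)
    then have "sqrt M \<le> 2 * \<bar>C\<bar> * (2 * pi) powr (1 / p) * real N powr (1 / p)"
      by (simp add: powr_mult mult_ac)
    then have "(sqrt M)\<^sup>2 \<le> (2 * \<bar>C\<bar> * (2 * pi) powr (1 / p) * real N powr (1 / p))\<^sup>2"
      using M by (intro power_mono) auto
    also have "\<dots> = (2 * \<bar>C\<bar> * (2 * pi) powr (1 / p))\<^sup>2 * (real N powr (1 / p))\<^sup>2"
      by (rule power_mult_distrib)
    also have "(real N powr (1 / p))\<^sup>2 = real N powr (2 / p)"
      by (simp add: power2_eq_square flip: powr_add)
    finally show ?thesis
      using M by (simp add: M_def A_def)
  qed simp
  then show ?thesis
    by (intro that[of "(2 * \<bar>C\<bar> * (2 * pi) powr (1 / p))\<^sup>2"]) auto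
qed

text \<open>The range of \<open>k\<close> is cut into dyadic blocks. Block \<open>i\<close> has
  weights at most \<open>1 / 2 ^ i\<close> and at most \<open>C * (2 ^ i) powr (2 / p)\<close>
  elements, so it contributes at most \<open>C * q ^ i\<close> with \<open>q < 1\<close>. The
  geometric series bounds the total independently of \<open>j\<close>.\<close>

lemma Rudin_Lambda_harmonic_bound:
  assumes p: "p > 2" and Lambda: "Rudin_Lambda p (int ` E)"
  obtains K where "\<And>j N. (\<Sum>k<N. if j + k \<in> E then 1 / (real k + 1) else 0) \<le> K"
proof -
  obtain C where C: "C \<ge> 0" "\<And>j N. N \<ge> 1 \<Longrightarrow> real (card (E \<inter> {j..<j + N})) \<le> C * real N powr (2 / p)"
    using Rudin_Lambda_card_bound[OF assms] by blast
  define q :: real where "q = 2 powr (2 / p - 1)"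
  have q: "0 < q" "q < 1"
    using p unfolding q_def by (auto intro!: powr_less_one simp: field_simps)
  let ?h = "\<lambda>j k. if j + k \<in> E then 1 / (real k + 1) else 0"
  \<comment> \<open>Block \<open>i\<close> is \<open>2 ^ i <= k + 1 < 2 ^ Suc i\<close>; the shift
    by one matches the weights \<open>1 / (k + 1)\<close>.\<close>
  have block: "(\<Sum>k=2^i - 1..<2^Suc i - 1. ?h j k) \<le> C * q ^ i" for i j :: nat
  proof -
    have "(\<Sum>k=2^i - 1..<2^Suc i - 1. ?h j k) \<le> (\<Sum>k=2^i - 1..<2^Suc i - 1. if j + k \<in> E then 1 / 2 ^ i else 0)"
    proof (rule sum_mono)
      fix k :: nat
      assume "k \<in> {2^i - 1..<2^Suc i - 1}"
      then have "2 ^ i \<le> k + 1"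
        by auto
      then have "real (2 ^ i) \<le> real (k + 1)"
        by (rule of_nat_mono)
      then show "?h j k \<le> (if j + k \<in> E then 1 / 2 ^ i else 0)"
        by (simp add: frac_le)
    qed
    also have "\<dots> = (\<Sum>k\<in>{k\<in>{2^i - 1..<2^Suc i - 1}. j + k \<in> E}. 1 / 2 ^ i)"
      by (rule sum.inter_filter[symmetric]) simp
    also have "\<dots> = real (card {k\<in>{2^i - 1..<2^Suc i - 1}. j + k \<in> E}) / 2 ^ i"
      by simp
    also have "card {k\<in>{2^i - 1..<2^Suc i - 1}. j + k \<in> E} \<le> card (E \<inter> {j + (2^i - 1)..<j + (2^i - 1) + 2^i})"
      by (rule card_inj_on_le[of "\<lambda>k. j + k"]) auto
    also have "real (card (E \<inter> {j + (2^i - 1)..<j + (2^i - 1) + 2^i})) \<le> C * real (2^i) powr (2 / p)"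
      by (rule C(2)) simp
    also have "C * real (2^i) powr (2 / p) / 2 ^ i = C * q ^ i"
    proof -
      have "real (2 ^ i) powr (2 / p) / 2 ^ i = 2 powr (real i * (2 / p)) / 2 powr real i"
        by (simp add: powr_powr flip: powr_realpow)
      also have "\<dots> = 2 powr ((2 / p - 1) * real i)"
        by (simp add: powr_diff[symmetric] algebra_simps)
      also have "\<dots> = q ^ i"
        using q(1) by (simp add: q_def powr_powr flip: powr_realpow)
      finally have "C * (real (2 ^ i) powr (2 / p) / 2 ^ i) = C * q ^ i"
        by (rule arg_cong)
      then show ?thesis
        by simp
    qed
    finally show ?thesis
      by (simp add: divide_right_mono)
  qed
  have dyadic: "(\<Sum>k<2^i - 1. ?h j k) \<le> C * (\<Sum>i'<i. q ^ i')" for i j :: nat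
  proof (induction i)
    case (Suc i)
    have "(\<Sum>k<2^Suc i - 1. ?h j k) = (\<Sum>k<2^i - 1. ?h j k) + (\<Sum>k=2^i - 1..<2^Suc i - 1. ?h j k)"
      using sum.atLeastLessThan_concat[of 0 "2^i - 1" "2^Suc i - 1" "?h j"]
      by (simp add: lessThan_atLeast0 diff_le_mono)
    with Suc block[of j i] show ?case
      by (simp add: algebra_simps)
  qed simp
  show thesis
  proof (rule that)
    fix j N :: nat
    have "N < 2 ^ N"
      by (rule less_exp)
    then have "N \<le> 2 ^ N - 1"
      by linarith
    then have "(\<Sum>k<N. ?h j k) \<le> (\<Sum>k<2^N - 1. ?h j k)"
      by (intro sum_mono2) auto
    also have "\<dots> \<le> C * (\<Sum>i<N. q ^ i)"
      by (rule dyadic)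
    also have "\<dots> \<le> C * (1 / (1 - q))"
      using q C(1) by (intro mult_left_mono) (auto simp: suminf_geometric[symmetric] intro!: sum_le_suminf summable_geometric)
    finally show "(\<Sum>k<N. ?h j k) \<le> C * (1 / (1 - q))" .
  qed
qed

subsection \<open>The Hankel form\<close>

text \<open>Cauchy--Schwarz with the weights \<open>1 / (k + 1)\<close>, then the substitution \<open>m = n + k\<close>.\<close>

lemma hankel_form_finite_bound:
  fixes l a :: "nat \<Rightarrow> complex"
  assumes K: "\<And>j N. (\<Sum>k<N. if j + k \<in> E then 1 / (real k + 1) else 0) \<le> K"
    and l: "\<And>n. n \<notin> E \<Longrightarrow> l n = 0"
  shows "(\<Sum>n<M. (real n + 1) * (\<Sum>k<N. norm (l (n + k) * a k))\<^sup>2)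
    \<le> K * (\<Sum>m<M + N. (real m + 1) * (norm (l m))\<^sup>2 * (\<Sum>k\<le>m. (real k + 1) * (norm (a k))\<^sup>2))"
proof -
  let ?A = "\<lambda>k. (real k + 1) * (norm (a k))\<^sup>2"
  let ?L = "\<lambda>m. (real m + 1) * (norm (l m))\<^sup>2"
  have K0: "0 \<le> K"
    using K[of 0 0] by simp
  have row: "(\<Sum>k<N. norm (l (n + k) * a k))\<^sup>2 \<le> K * (\<Sum>k<N. (norm (l (n + k)))\<^sup>2 * ?A k)" for n
  proof -
    \<comment> \<open>Since \<open>l\<close> vanishes off \<open>E\<close>, the indicator of
      \<open>n + k \<in> E\<close> may be put into \<open>?u\<close>, whose squares then sum to at
      most \<open>K\<close>.\<close>
    let ?u = "\<lambda>k. if n + k \<in> E then 1 / sqrt (real k + 1) else 0"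
    let ?v = "\<lambda>k. norm (l (n + k)) * (sqrt (real k + 1) * norm (a k))"
    have "(\<Sum>k<N. norm (l (n + k) * a k)) = (\<Sum>k<N. ?u k * ?v k)"
      by (intro sum.cong refl) (auto simp: l norm_mult)
    then have "(\<Sum>k<N. norm (l (n + k) * a k))\<^sup>2 \<le> (\<Sum>k<N. (?u k)\<^sup>2) * (\<Sum>k<N. (?v k)\<^sup>2)"
      using Cauchy_Schwarz_ineq_sum[of ?u ?v "{..<N}"] by simp
    also have "(\<Sum>k<N. (?u k)\<^sup>2) = (\<Sum>k<N. if n + k \<in> E then 1 / (real k + 1) else 0)"
      by (intro sum.cong refl) (auto simp: power_divide)
    also have "(\<Sum>k<N. (?v k)\<^sup>2) = (\<Sum>k<N. (norm (l (n + k)))\<^sup>2 * ?A k)"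
      by (intro sum.cong refl) (auto simp: power_mult_distrib)
    also have "(\<Sum>k<N. if n + k \<in> E then 1 / (real k + 1) else 0) * (\<Sum>k<N. (norm (l (n + k)))\<^sup>2 * ?A k)
        \<le> K * (\<Sum>k<N. (norm (l (n + k)))\<^sup>2 * ?A k)"
      by (intro mult_right_mono K sum_nonneg) auto
    finally show ?thesis .
  qed
  have "(\<Sum>n<M. (real n + 1) * (\<Sum>k<N. norm (l (n + k) * a k))\<^sup>2)
      \<le> (\<Sum>n<M. (real n + 1) * (K * (\<Sum>k<N. (norm (l (n + k)))\<^sup>2 * ?A k)))"
    by (intro sum_mono mult_left_mono row) auto
  also have "\<dots> = K * (\<Sum>n<M. \<Sum>k<N. (real n + 1) * (norm (l (n + k)))\<^sup>2 * ?A k)"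
    by (simp add: sum_distrib_left mult_ac)
  \<comment> \<open>As \<open>n + 1 <= n + k + 1\<close>, the weight may be taken at the new index
    \<open>m = n + k\<close>.\<close>
  also have "(\<Sum>n<M. \<Sum>k<N. (real n + 1) * (norm (l (n + k)))\<^sup>2 * ?A k) \<le> (\<Sum>n<M. \<Sum>k<N. ?L (n + k) * ?A k)"
    by (intro sum_mono mult_right_mono) auto
  also have "\<dots> = (\<Sum>(n, k)\<in>{..<M} \<times> {..<N}. ?L (n + k) * ?A k)"
    by (rule sum.cartesian_product)
  also have "\<dots> = (\<Sum>(m, k)\<in>(\<lambda>(n, k). (n + k, k)) ` ({..<M} \<times> {..<N}). ?L m * ?A k)"
    by (subst sum.reindex) (auto simp: inj_on_def intro!: sum.cong)
  \<comment> \<open>The image lies in the region \<open>k <= m < M + N\<close>, and the added terms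
    are nonnegative.\<close>
  also have "\<dots> \<le> (\<Sum>(m, k)\<in>Sigma {..<M + N} (\<lambda>m. {..m}). ?L m * ?A k)"
    by (intro sum_mono2) auto
  also have "\<dots> = (\<Sum>m<M + N. ?L m * (\<Sum>k\<le>m. ?A k))"
    by (subst sum.Sigma[symmetric]) (auto simp: sum_distrib_left)
  finally show ?thesis
    using K0 by (simp add: mult_left_mono)
qed

text \<open>The finite bound is uniform in \<open>M\<close> and \<open>N\<close>. Applied to a
  single row it gives absolute convergence; then first \<open>N\<close> and afterwards
  \<open>M\<close> may tend to infinity.\<close>

lemma hankel_form_bound:
  fixes l a :: "nat \<Rightarrow> complex"
  assumes K: "\<And>j N. (\<Sum>k<N. if j + k \<in> E then 1 / (real k + 1) else 0) \<le> K"
    and l: "\<And>n. n \<notin> E \<Longrightarrow> l n = 0"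
    and T: "summable (\<lambda>m. (real m + 1) * (norm (l m))\<^sup>2 * (\<Sum>k\<le>m. (real k + 1) * (norm (a k))\<^sup>2))"
  shows "summable (\<lambda>k. norm (l (n + k) * a k))"
    and "summable (\<lambda>n. (real n + 1) * (norm (\<Sum>k. l (n + k) * a k))\<^sup>2)"
    and "(\<Sum>n. (real n + 1) * (norm (\<Sum>k. l (n + k) * a k))\<^sup>2)
      \<le> K * (\<Sum>m. (real m + 1) * (norm (l m))\<^sup>2 * (\<Sum>k\<le>m. (real k + 1) * (norm (a k))\<^sup>2))"
proof -
  define t where "t = (\<lambda>m. (real m + 1) * (norm (l m))\<^sup>2 * (\<Sum>k\<le>m. (real k + 1) * (norm (a k))\<^sup>2))"
  have t0: "0 \<le> t m" for m
    by (auto simp: t_def intro!: mult_nonneg_nonneg sum_nonneg)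
  have K0: "0 \<le> K"
    using K[of 0 0] by simp
  have fin: "(\<Sum>n<M. (real n + 1) * (\<Sum>k<N. norm (l (n + k) * a k))\<^sup>2) \<le> K * suminf t" for M N
  proof -
    have "(\<Sum>n<M. (real n + 1) * (\<Sum>k<N. norm (l (n + k) * a k))\<^sup>2) \<le> K * sum t {..<M + N}"
      unfolding t_def using K l by (rule hankel_form_finite_bound)
    also have "\<dots> \<le> K * suminf t"
      using T t0 K0 by (intro mult_left_mono sum_le_suminf) (auto simp: t_def[symmetric])
    finally show ?thesis .
  qed
  have summ: "summable (\<lambda>k. norm (l (n + k) * a k))" for n
  proof (rule bounded_imp_summable)
    fix N
    let ?s = "\<Sum>k\<le>N. norm (l (n + k) * a k)"
    have "1 * ?s\<^sup>2 \<le> (real n + 1) * ?s\<^sup>2"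
      by (rule mult_right_mono) auto
    \<comment> \<open>The row \<open>n\<close> is one term of the finite form with
      \<open>Suc n\<close> rows.\<close>
    also have "\<dots> \<le> (\<Sum>n<Suc n. (real n + 1) * (\<Sum>k<Suc N. norm (l (n + k) * a k))\<^sup>2)"
      by (simp only: lessThan_Suc_atMost) (rule member_le_sum, auto)
    also have "\<dots> \<le> K * suminf t"
      by (rule fin)
    finally show "?s \<le> sqrt (K * suminf t)"
      by (intro real_le_rsqrt) simp
  qed simp
  show "summable (\<lambda>k. norm (l (n + k) * a k))"
    by (rule summ)
  have bound: "(\<Sum>n<M. (real n + 1) * (norm (\<Sum>k. l (n + k) * a k))\<^sup>2) \<le> K * suminf t" for M
  proof -
    have "(\<lambda>N. \<Sum>n<M. (real n + 1) * (\<Sum>k<N. norm (l (n + k) * a k))\<^sup>2)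
      \<longlonglongrightarrow> (\<Sum>n<M. (real n + 1) * (\<Sum>k. norm (l (n + k) * a k))\<^sup>2)"
      by (intro tendsto_intros summable_LIMSEQ summ)
    then have "(\<Sum>n<M. (real n + 1) * (\<Sum>k. norm (l (n + k) * a k))\<^sup>2) \<le> K * suminf t"
      by (rule LIMSEQ_le_const2) (use fin in blast)
    moreover have "(\<Sum>n<M. (real n + 1) * (norm (\<Sum>k. l (n + k) * a k))\<^sup>2)
        \<le> (\<Sum>n<M. (real n + 1) * (\<Sum>k. norm (l (n + k) * a k))\<^sup>2)"
      by (intro sum_mono mult_left_mono power_mono summable_norm summ) auto
    ultimately show ?thesis
      by linarith
  qed
  show s2: "summable (\<lambda>n. (real n + 1) * (norm (\<Sum>k. l (n + k) * a k))\<^sup>2)"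
    using bound[of "Suc _"] by (intro bounded_imp_summable[where B = "K * suminf t"]) (simp_all only: lessThan_Suc_atMost, simp)
  show "(\<Sum>n. (real n + 1) * (norm (\<Sum>k. l (n + k) * a k))\<^sup>2)
      \<le> K * (\<Sum>m. (real m + 1) * (norm (l m))\<^sup>2 * (\<Sum>k\<le>m. (real k + 1) * (norm (a k))\<^sup>2))"
    using s2 bound by (intro suminf_le_const) (auto simp: t_def)
qed

subsection \<open>Hankel operators on the Dirichlet space\<close>

text \<open>Elements of the space are total functions identified on the disk; the derivative at a
  point of the open disk depends only on nearby values.\<close>

lemma Dirichlet_norm_cong:
  assumes "\<And>z. norm z < 1 \<Longrightarrow> f z = g z"
  shows "Dirichlet_norm f = Dirichlet_norm g"
proof -
  have "deriv f z = deriv g z" if "norm z < 1" for z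
  proof (rule deriv_cong_ev)
    have "eventually (\<lambda>u. u \<in> ball 0 1) (nhds z)"
      using that by (intro eventually_nhds_in_open) auto
    then show "eventually (\<lambda>u. f u = g u) (nhds z)"
      by eventually_elim (use assms in auto)
  qed simp
  then have "(LINT z|disk_area. (norm (deriv f z))\<^sup>2) = (LINT z|disk_area. (norm (deriv g z))\<^sup>2)"
    by (intro Bochner_Integration.integral_cong) auto
  then show ?thesis
    using assms[of 0] by (simp add: Dirichlet_norm_def)
qed

lemma taylor_coeff_linear_combination:
  assumes f: "f holomorphic_on ball 0 1" and g: "g holomorphic_on ball 0 1"
  shows "taylor_coeff (\<lambda>z. c * f z + d * g z) = (\<lambda>k. c * taylor_coeff f k + d * taylor_coeff g k)"
proof (rule taylor_coeff_power_series)
  fix z :: complex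
  assume z: "norm z < 1"
  show "(\<lambda>k. (c * taylor_coeff f k + d * taylor_coeff g k) * z ^ k) sums (c * f z + d * g z)"
    using sums_add[OF sums_mult[OF taylor_coeff_sums[OF f z], of c] sums_mult[OF taylor_coeff_sums[OF g z], of d]]
    by (simp add: algebra_simps)
qed

lemma Dirichlet_space_linear_combination:
  assumes f: "f \<in> Dirichlet_space" and g: "g \<in> Dirichlet_space"
  shows "(\<lambda>z. c * f z + d * g z) \<in> Dirichlet_space"
proof -
  let ?w = "\<lambda>h k. (real k + 1) * (norm (taylor_coeff h k))\<^sup>2"
  let ?h = "\<lambda>z. c * f z + d * g z"
  have holo: "f holomorphic_on ball 0 1" "g holomorphic_on ball 0 1" and summ: "summable (?w f)" "summable (?w g)"
    using f g by (auto simp: Dirichlet_space_iff_summable)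
  have "summable (\<lambda>k. 2 * (norm c)\<^sup>2 * ?w f k + 2 * (norm d)\<^sup>2 * ?w g k)"
    by (intro summable_add summable_mult summ)
  moreover have "norm (?w ?h k) \<le> 2 * (norm c)\<^sup>2 * ?w f k + 2 * (norm d)\<^sup>2 * ?w g k" for k
  proof -
    let ?x = "c * taylor_coeff f k" and ?y = "d * taylor_coeff g k"
    have "(norm (?x + ?y))\<^sup>2 \<le> (norm ?x + norm ?y)\<^sup>2"
      by (intro power_mono norm_triangle_ineq) auto
    also have "\<dots> \<le> 2 * (norm ?x)\<^sup>2 + 2 * (norm ?y)\<^sup>2"
      using zero_le_power2[of "norm ?x - norm ?y"] by (simp add: power2_eq_square algebra_simps)
    finally have "(real k + 1) * (norm (?x + ?y))\<^sup>2 \<le> (real k + 1) * (2 * (norm ?x)\<^sup>2 + 2 * (norm ?y)\<^sup>2)"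
      by (intro mult_left_mono) auto
    then show ?thesis
      by (simp add: taylor_coeff_linear_combination[OF holo] norm_mult power_mult_distrib algebra_simps)
  qed
  ultimately have "summable (?w ?h)"
    by (rule summable_comparison_test'[where N = 0])
  then show ?thesis
    using holo by (auto simp: Dirichlet_space_iff_summable intro!: holomorphic_intros)
qed

section \<open>Sufficiency of the coefficient condition: boundedness and compactness\<close>

context
  fixes E :: "nat set" and l :: "nat \<Rightarrow> complex" and K :: real
  assumes K: "\<And>j N. (\<Sum>k<N. if j + k \<in> E then 1 / (real k + 1) else 0) \<le> K"
    and l0: "\<And>n. n \<notin> E \<Longrightarrow> l n = 0"
    and l_sq: "summable (\<lambda>n. (real n + 1) * (norm (l n))\<^sup>2)"
begin

lemma K_nonneg: "0 \<le> K"
  using K[of 0 0] by simp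

context
  fixes f :: "complex \<Rightarrow> complex"
  assumes f: "f \<in> Dirichlet_space"
begin

text \<open>Each inner partial sum is at most the full sum, which decouples the symbol from
  \<open>f\<close>. The product bound serves boundedness; compactness works with the series before
  decoupling.\<close>

lemma summable_weighted_partial_sums:
  "summable (\<lambda>m. (real m + 1) * (norm (l m))\<^sup>2 * (\<Sum>k\<le>m. (real k + 1) * (norm (taylor_coeff f k))\<^sup>2))"
  and suminf_weighted_partial_sums_le:
  "(\<Sum>m. (real m + 1) * (norm (l m))\<^sup>2 * (\<Sum>k\<le>m. (real k + 1) * (norm (taylor_coeff f k))\<^sup>2))
    \<le> (\<Sum>n. (real n + 1) * (norm (l n))\<^sup>2) * (\<Sum>k. (real k + 1) * (norm (taylor_coeff f k))\<^sup>2)"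
proof -
  let ?A = "\<lambda>k. (real k + 1) * (norm (taylor_coeff f k))\<^sup>2"
  let ?L = "\<lambda>m. (real m + 1) * (norm (l m))\<^sup>2"
  have A: "summable ?A"
    using f by (simp add: Dirichlet_space_iff_summable)
  have le: "?L m * (\<Sum>k\<le>m. ?A k) \<le> ?L m * suminf ?A" for m
    by (intro mult_left_mono sum_le_suminf A) auto
  have summ: "summable (\<lambda>m. ?L m * suminf ?A)"
    by (intro summable_mult2 l_sq)
  then show *: "summable (\<lambda>m. ?L m * (\<Sum>k\<le>m. ?A k))"
    by (rule summable_comparison_test') (use le in \<open>auto simp: sum_nonneg\<close>)
  show "(\<Sum>m. ?L m * (\<Sum>k\<le>m. ?A k)) \<le> suminf ?L * suminf ?A"
    unfolding suminf_mult2[OF l_sq] by (intro suminf_le le * summ)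
qed

lemma summable_hankel_coeff: "summable (\<lambda>k. l (n + k) * taylor_coeff f k)"
proof (rule summable_norm_cancel)
  show "summable (\<lambda>k. norm (l (n + k) * taylor_coeff f k))"
    using K l0 summable_weighted_partial_sums by (rule hankel_form_bound(1))
qed

lemma summable_hankel_coeff_sq: "summable (\<lambda>n. (real n + 1) * (norm (hankel_coeff l f n))\<^sup>2)"
  unfolding hankel_coeff_def using K l0 summable_weighted_partial_sums by (rule hankel_form_bound(2))

lemma hankel_in_Dirichlet: "hankel l f \<in> Dirichlet_space"
  and taylor_coeff_hankel: "taylor_coeff (hankel l f) = hankel_coeff l f"
  using Dirichlet_power_series[OF summable_hankel_coeff_sq, of "hankel l f"] by (auto simp: hankel_def)

lemma hankel_well_defined_of_summable: "hankel_well_defined l f"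
  unfolding hankel_well_defined_def
proof (intro conjI allI ballI)
  show "summable (\<lambda>n. hankel_coeff l f n * z ^ n)" if "z \<in> ball 0 1" for z
    using summable_power_series_ball[OF summable_hankel_coeff_sq, of z] that
    by (intro summable_norm_cancel[of "\<lambda>n. hankel_coeff l f n * z ^ n"]) simp
  show "hankel l f holomorphic_on ball 0 1"
    using hankel_in_Dirichlet by (simp add: Dirichlet_space_def)
qed (rule summable_hankel_coeff)

lemma Dirichlet_norm_hankel_sq:
  "(Dirichlet_norm (hankel l f))\<^sup>2
    \<le> K * (\<Sum>m. (real m + 1) * (norm (l m))\<^sup>2 * (\<Sum>k\<le>m. (real k + 1) * (norm (taylor_coeff f k))\<^sup>2))"
proof -
  have "(Dirichlet_norm (hankel l f))\<^sup>2 \<le> (\<Sum>n. (real n + 1) * (norm (hankel_coeff l f n))\<^sup>2)"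
    using Dirichlet_norm_sq_le[OF hankel_in_Dirichlet] by (simp add: taylor_coeff_hankel)
  also have "\<dots> \<le> K * (\<Sum>m. (real m + 1) * (norm (l m))\<^sup>2 * (\<Sum>k\<le>m. (real k + 1) * (norm (taylor_coeff f k))\<^sup>2))"
    unfolding hankel_coeff_def using K l0 summable_weighted_partial_sums by (rule hankel_form_bound(3))
  finally show ?thesis .
qed

end

text \<open>Both series in the definition converge, so linearity passes through each of them. The
  form covers sums, scalar multiples (\<open>d = 0\<close>) and the differences in the compactness
  proof (\<open>d = - 1\<close>).\<close>

lemma hankel_linear_combination:
  assumes f: "f \<in> Dirichlet_space" and g: "g \<in> Dirichlet_space" and z: "norm z < 1"
  shows "hankel l (\<lambda>w. c * f w + d * g w) z = c * hankel l f z + d * hankel l g z"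
proof -
  have holo: "f holomorphic_on ball 0 1" "g holomorphic_on ball 0 1"
    using f g by (auto simp: Dirichlet_space_def)
  have coeff: "hankel_coeff l (\<lambda>w. c * f w + d * g w) n = c * hankel_coeff l f n + d * hankel_coeff l g n" for n
  proof -
    have "(\<lambda>k. c * (l (n + k) * taylor_coeff f k) + d * (l (n + k) * taylor_coeff g k))
        sums (c * hankel_coeff l f n + d * hankel_coeff l g n)"
      unfolding hankel_coeff_def by (intro sums_add sums_mult summable_sums summable_hankel_coeff f g)
    then show ?thesis
      unfolding hankel_coeff_def[of l "\<lambda>w. c * f w + d * g w"] taylor_coeff_linear_combination[OF holo]
      by (intro sums_unique[symmetric]) (simp add: algebra_simps)
  qed
  have sums: "(\<lambda>n. hankel_coeff l h n * z ^ n) sums hankel l h z" if "h \<in> Dirichlet_space" for h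
    unfolding hankel_def using hankel_well_defined_of_summable[OF that] z
    by (intro summable_sums) (simp add: hankel_well_defined_def)
  have "(\<lambda>n. c * (hankel_coeff l f n * z ^ n) + d * (hankel_coeff l g n * z ^ n))
      sums (c * hankel l f z + d * hankel l g z)"
    by (intro sums_add sums_mult sums f g)
  then show ?thesis
    unfolding hankel_def[of l "\<lambda>w. c * f w + d * g w"] coeff
    by (intro sums_unique[symmetric]) (simp add: algebra_simps)
qed

lemma hankel_bounded_of_summable: "hankel_bounded l"
  unfolding hankel_bounded_def
proof (intro conjI ballI exI)
  define \<Lambda> where "\<Lambda> = (\<Sum>n. (real n + 1) * (norm (l n))\<^sup>2)"
  have \<Lambda>: "0 \<le> \<Lambda>"
    unfolding \<Lambda>_def by (intro suminf_nonneg l_sq) auto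
  \<comment> \<open>The \<open>2\<close> stems from \<open>Dirichlet_norm_sq_ge\<close>; adding
    \<open>1\<close> keeps the constant positive when \<open>K * \<Lambda>\<close> is zero.\<close>
  show "0 < sqrt (2 * K * \<Lambda>) + 1"
    using K_nonneg \<Lambda> by (intro add_nonneg_pos) auto
  fix f
  assume f: "f \<in> Dirichlet_space"
  show "hankel_well_defined l f" "hankel l f \<in> Dirichlet_space"
    using f by (rule hankel_well_defined_of_summable hankel_in_Dirichlet)+
  have "(Dirichlet_norm (hankel l f))\<^sup>2 \<le> K * (\<Lambda> * (\<Sum>k. (real k + 1) * (norm (taylor_coeff f k))\<^sup>2))"
    unfolding \<Lambda>_def
    by (rule order_trans[OF Dirichlet_norm_hankel_sq[OF f]])
      (intro mult_left_mono suminf_weighted_partial_sums_le f K_nonneg)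
  also have "\<dots> \<le> K * (\<Lambda> * (2 * (Dirichlet_norm f)\<^sup>2))"
    by (intro mult_left_mono Dirichlet_norm_sq_ge f K_nonneg \<Lambda>)
  finally have "Dirichlet_norm (hankel l f) \<le> sqrt (2 * K * \<Lambda> * (Dirichlet_norm f)\<^sup>2)"
    by (intro real_le_rsqrt) (simp add: mult_ac)
  also have "\<dots> = sqrt (2 * K * \<Lambda>) * Dirichlet_norm f"
    by (simp add: real_sqrt_mult Dirichlet_norm_nonneg)
  also have "\<dots> \<le> (sqrt (2 * K * \<Lambda>) + 1) * Dirichlet_norm f"
    by (intro mult_right_mono Dirichlet_norm_nonneg) auto
  finally show "Dirichlet_norm (hankel l f) \<le> (sqrt (2 * K * \<Lambda>) + 1) * Dirichlet_norm f" .
qed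

text \<open>Coefficientwise convergence gives norm convergence of the images: the bound
  \<open>Dirichlet_norm_hankel_sq\<close> only involves partial sums, so dominated convergence applies.\<close>

lemma hankel_tendsto_zero:
  assumes F: "\<And>j. F j \<in> Dirichlet_space"
    and B: "\<And>j. (\<Sum>k. (real k + 1) * (norm (taylor_coeff (F j) k))\<^sup>2) \<le> B"
    and lim: "\<And>k. (\<lambda>j. taylor_coeff (F j) k) \<longlonglongrightarrow> 0"
  shows "(\<lambda>j. Dirichlet_norm (hankel l (F j))) \<longlonglongrightarrow> 0"
proof -
  let ?A = "\<lambda>j k. (real k + 1) * (norm (taylor_coeff (F j) k))\<^sup>2"
  let ?L = "\<lambda>m. (real m + 1) * (norm (l m))\<^sup>2"
  let ?T = "\<lambda>j m. ?L m * (\<Sum>k\<le>m. ?A j k)"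
  have A: "summable (?A j)" for j
    using F[of j] by (simp add: Dirichlet_space_iff_summable)
  have T_le: "norm (?T j m) \<le> ?L m * B" for j m
  proof -
    have "(\<Sum>k\<le>m. ?A j k) \<le> suminf (?A j)"
      by (intro sum_le_suminf A) auto
    with B[of j] have "(\<Sum>k\<le>m. ?A j k) \<le> B"
      by linarith
    then have "?T j m \<le> ?L m * B"
      by (intro mult_left_mono) auto
    moreover have "0 \<le> ?T j m"
      by (intro mult_nonneg_nonneg sum_nonneg) auto
    ultimately show ?thesis
      by simp
  qed
  have "(\<lambda>j. \<Sum>m. ?T j m) \<longlonglongrightarrow> (\<Sum>m. 0)"
  \<comment> \<open>The series \<open>?L m * B\<close> dominates; for fixed \<open>m\<close> only
    finitely many coefficients occur, and each tends to \<open>0\<close>.\<close>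
  proof (rule tannerys_theorem[THEN conjunct2, THEN conjunct2])
    show "eventually (\<lambda>(m, j). norm (?T j m) \<le> ?L m * B) (at_top \<times>\<^sub>F sequentially)"
      using T_le by (intro always_eventually) auto
    show "summable (\<lambda>m. ?L m * B)"
      by (intro summable_mult2 l_sq)
    show "(\<lambda>j. ?T j m) \<longlonglongrightarrow> 0" for m
    proof -
      have "(\<lambda>j. ?T j m) \<longlonglongrightarrow> ?L m * (\<Sum>k\<le>m. (real k + 1) * (norm (0::complex))\<^sup>2)"
        by (intro tendsto_intros lim)
      then show ?thesis
        by simp
    qed
  qed simp
  then have "(\<lambda>j. K * (\<Sum>m. ?T j m)) \<longlonglongrightarrow> 0"
    using tendsto_mult_right_zero[of "\<lambda>j. \<Sum>m. ?T j m" sequentially K] by simp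
  then have "(\<lambda>j. (Dirichlet_norm (hankel l (F j)))\<^sup>2) \<longlonglongrightarrow> 0"
    by (rule tendsto_sandwich[OF always_eventually always_eventually tendsto_const, rotated 2])
      (use Dirichlet_norm_hankel_sq[OF F] in auto)
  then have "(\<lambda>j. sqrt ((Dirichlet_norm (hankel l (F j)))\<^sup>2)) \<longlonglongrightarrow> sqrt 0"
    by (rule tendsto_real_sqrt)
  then show ?thesis
    by (simp add: Dirichlet_norm_nonneg)
qed

text \<open>Bounded norms bound every Taylor coefficient, so a subsequence converges coefficientwise
  to some \<open>c\<close>. These are the coefficients of a Dirichlet function \<open>g\<close>, and
  \<open>hankel_tendsto_zero\<close> applied to the differences makes the images converge to
  \<open>hankel l g\<close>.\<close>

lemma hankel_compact_of_summable: "hankel_compact l"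
  unfolding hankel_compact_def Dirichlet_compact_operator_def
proof (intro conjI allI impI)
  show "hankel_bounded l"
    by (rule hankel_bounded_of_summable)
  show "Dirichlet_linear (hankel l)"
    unfolding Dirichlet_linear_def
  proof (intro conjI ballI allI)
    fix f g :: "complex \<Rightarrow> complex" and c z :: complex
    assume f: "f \<in> Dirichlet_space"
    show "hankel l f \<in> Dirichlet_space"
      using f by (rule hankel_in_Dirichlet)
    assume z: "z \<in> ball 0 1"
    show "hankel l (\<lambda>w. c * f w) z = c * hankel l f z"
      using hankel_linear_combination[OF f f, of z c 0] z by simp
    assume g: "g \<in> Dirichlet_space"
    show "hankel l (\<lambda>w. f w + g w) z = hankel l f z + hankel l g z"
      using hankel_linear_combination[OF f g, of z 1 1] z by simp
  qed
next
  fix F :: "nat \<Rightarrow> complex \<Rightarrow> complex"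
  assume F: "\<forall>j. F j \<in> Dirichlet_space" and "\<exists>B. \<forall>j. Dirichlet_norm (F j) \<le> B"
  then obtain B where B: "Dirichlet_norm (F j) \<le> B" for j
    by blast
  let ?A = "\<lambda>j k. (real k + 1) * (norm (taylor_coeff (F j) k))\<^sup>2"
  have A: "summable (?A j)" for j
    using F by (simp add: Dirichlet_space_iff_summable)
  have A_le: "suminf (?A j) \<le> 2 * B\<^sup>2" for j
  proof -
    have "(Dirichlet_norm (F j))\<^sup>2 \<le> B\<^sup>2"
      by (intro power_mono B Dirichlet_norm_nonneg)
    then show ?thesis
      using Dirichlet_norm_sq_ge[of "F j"] F by fastforce
  qed
  have A_part: "(\<Sum>k<n. ?A j k) \<le> 2 * B\<^sup>2" for j n
    by (rule order_trans[OF _ A_le[of j]]) (intro sum_le_suminf A, auto)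
  have coeff_le: "norm (taylor_coeff (F j) k) \<le> sqrt (2 * B\<^sup>2)" for j k
  proof (rule real_le_rsqrt)
    have "1 * (norm (taylor_coeff (F j) k))\<^sup>2 \<le> ?A j k"
      by (intro mult_right_mono) auto
    also have "\<dots> \<le> (\<Sum>k<Suc k. ?A j k)"
      by (rule member_le_sum) auto
    finally show "(norm (taylor_coeff (F j) k))\<^sup>2 \<le> 2 * B\<^sup>2"
      using A_part[of j "Suc k"] by linarith
  qed
  \<comment> \<open>Each coefficient stays in a closed disk; a diagonal argument extracts one
    subsequence good for all \<open>k\<close>.\<close>
  obtain r :: "nat \<Rightarrow> nat" where r: "strict_mono r"
    and "\<And>k. k \<in> UNIV \<Longrightarrow> \<exists>c. (\<lambda>j. taylor_coeff (F (r j)) k) \<longlonglongrightarrow> c"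
    by (rule function_convergent_subsequence[of "UNIV :: nat set" "\<lambda>j. taylor_coeff (F j)"])
      (use coeff_le in auto)
  then obtain c where c: "(\<lambda>j. taylor_coeff (F (r j)) k) \<longlonglongrightarrow> c k" for k
    by (metis UNIV_I)
  \<comment> \<open>As in Fatou's lemma, the bounds on finite partial sums pass to the limit, which
    makes the weighted sum of \<open>c\<close> converge.\<close>
  have c_part: "(\<Sum>k<n. (real k + 1) * (norm (c k))\<^sup>2) \<le> 2 * B\<^sup>2" for n
    by (rule LIMSEQ_le_const2[where X = "\<lambda>j. \<Sum>k<n. ?A (r j) k"]) (intro tendsto_intros c, use A_part in blast)
  have c_summ: "summable (\<lambda>k. (real k + 1) * (norm (c k))\<^sup>2)"
    using c_part[of "Suc _"]
    by (intro bounded_imp_summable[where B = "2 * B\<^sup>2"]) (simp_all only: lessThan_Suc_atMost, simp)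
  define g where "g = (\<lambda>z. \<Sum>k. c k * z ^ k)"
  have g: "g \<in> Dirichlet_space" and g_coeff: "taylor_coeff g = c"
    using Dirichlet_power_series[OF c_summ, of g] by (simp_all add: g_def)
  let ?G = "\<lambda>j z. 1 * F (r j) z + (- 1) * g z"
  have G: "?G j \<in> Dirichlet_space" for j
    using F g by (intro Dirichlet_space_linear_combination) auto
  have G_coeff: "taylor_coeff (?G j) k = taylor_coeff (F (r j)) k - c k" for j k
    using taylor_coeff_linear_combination[of "F (r j)" g 1 "-1"] F g by (simp add: Dirichlet_space_def g_coeff)
  have "(\<lambda>j. Dirichlet_norm (hankel l (?G j))) \<longlonglongrightarrow> 0"
  proof (rule hankel_tendsto_zero[OF G])
    show "(\<lambda>j. taylor_coeff (?G j) k) \<longlonglongrightarrow> 0" for k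
      unfolding G_coeff using tendsto_diff[OF c[of k] tendsto_const[of "c k"]] by simp
    \<comment> \<open>Both weighted sums are at most \<open>2 * B^2\<close>, and squaring a sum of
      two terms costs a factor \<open>2\<close>: \<open>2 * 2 + 2 * 2 = 8\<close>.\<close>
    show "(\<Sum>k. (real k + 1) * (norm (taylor_coeff (?G j) k))\<^sup>2) \<le> 8 * B\<^sup>2" for j
    proof (rule suminf_le_const)
      show "summable (\<lambda>k. (real k + 1) * (norm (taylor_coeff (?G j) k))\<^sup>2)"
        using G[of j] by (simp add: Dirichlet_space_iff_summable)
      fix n
      have "(real k + 1) * (norm (taylor_coeff (?G j) k))\<^sup>2 \<le> 2 * ?A (r j) k + 2 * ((real k + 1) * (norm (c k))\<^sup>2)" for k
      proof -
        let ?x = "norm (taylor_coeff (F (r j)) k)" and ?y = "norm (c k)"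
        have "(norm (taylor_coeff (?G j) k))\<^sup>2 \<le> (?x + ?y)\<^sup>2"
          unfolding G_coeff by (intro power_mono norm_triangle_ineq4) auto
        also have "\<dots> \<le> 2 * ?x\<^sup>2 + 2 * ?y\<^sup>2"
          using zero_le_power2[of "?x - ?y"] by (simp add: power2_eq_square algebra_simps)
        finally have "(real k + 1) * (norm (taylor_coeff (?G j) k))\<^sup>2 \<le> (real k + 1) * (2 * ?x\<^sup>2 + 2 * ?y\<^sup>2)"
          by (intro mult_left_mono) auto
        then show ?thesis
          by (simp add: algebra_simps)
      qed
      then have "(\<Sum>k<n. (real k + 1) * (norm (taylor_coeff (?G j) k))\<^sup>2)
          \<le> (\<Sum>k<n. 2 * ?A (r j) k + 2 * ((real k + 1) * (norm (c k))\<^sup>2))"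
        by (rule sum_mono)
      also have "\<dots> = 2 * (\<Sum>k<n. ?A (r j) k) + 2 * (\<Sum>k<n. (real k + 1) * (norm (c k))\<^sup>2)"
        by (simp only: sum.distrib sum_distrib_left)
      also have "\<dots> \<le> 8 * B\<^sup>2"
        using A_part[of "r j" n] c_part[of n] by linarith
      finally show "(\<Sum>k<n. (real k + 1) * (norm (taylor_coeff (?G j) k))\<^sup>2) \<le> 8 * B\<^sup>2" .
    qed
  qed
  \<comment> \<open>Linearity is available at points of the disk only, hence
    \<open>Dirichlet_norm_cong\<close>.\<close>
  moreover have "Dirichlet_norm (hankel l (?G j)) = Dirichlet_norm (\<lambda>z. hankel l (F (r j)) z - hankel l g z)" for j
    using F g hankel_linear_combination[of "F (r j)" g _ 1 "-1"] by (intro Dirichlet_norm_cong) auto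
  ultimately have "(\<lambda>j. Dirichlet_norm (\<lambda>z. hankel l (F (r j)) z - hankel l g z)) \<longlonglongrightarrow> 0"
    by simp
  then show "\<exists>g\<in>Dirichlet_space. \<exists>r. strict_mono (r :: nat \<Rightarrow> nat) \<and>
      (\<lambda>j. Dirichlet_norm (\<lambda>z. hankel l (F (r j)) z - g z)) \<longlonglongrightarrow> 0"
    using r hankel_in_Dirichlet[OF g] by blast
qed

end

section \<open>Necessity of the coefficient condition\<close>

text \<open>The constant function \<open>1\<close> has a single nonzero Taylor coefficient, so each
  Hankel coefficient collapses to one entry of \<open>l\<close>, and membership of the image in the
  space is the weighted condition.\<close>

lemma summable_of_hankel_bounded:
  assumes "hankel_bounded l"
  shows "summable (\<lambda>n. (real n + 1) * (norm (l n))\<^sup>2)"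
proof -
  have one: "(\<lambda>k. (if k = 0 then 1 else 0) * z ^ k) sums (1::complex)" for z
  proof -
    have "(\<lambda>k. (if k = 0 then 1 else 0) * z ^ k) = (\<lambda>k. if k = 0 then 1 else 0)"
      by auto
    then show ?thesis
      using sums_single[of 0 "\<lambda>_. 1 :: complex"] by simp
  qed
  have coeff: "taylor_coeff (\<lambda>_. 1) = (\<lambda>k. if k = 0 then 1 else 0)"
    by (intro taylor_coeff_power_series one)
  have "summable (\<lambda>k. (real k + 1) * (norm (taylor_coeff (\<lambda>_. 1) k))\<^sup>2)"
    by (rule summable_finite[of "{0}"]) (auto simp: coeff)
  then have "(\<lambda>_. 1) \<in> Dirichlet_space"
    by (simp add: Dirichlet_space_iff_summable)
  then have *: "hankel_well_defined l (\<lambda>_. 1)" "hankel l (\<lambda>_. 1) \<in> Dirichlet_space"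
    using assms by (auto simp: hankel_bounded_def)
  have "(\<lambda>k. l (n + k) * taylor_coeff (\<lambda>_. 1) k) = (\<lambda>k. if k = 0 then l n else 0)" for n
    by (auto simp: coeff)
  then have hc: "hankel_coeff l (\<lambda>_. 1) = l"
    using sums_unique[OF sums_single[of 0 "\<lambda>_. l _"]] by (auto simp: hankel_coeff_def)
  have "taylor_coeff (hankel l (\<lambda>_. 1)) = l"
  proof (rule taylor_coeff_power_series)
    fix z :: complex
    assume "norm z < 1"
    then show "(\<lambda>k. l k * z ^ k) sums hankel l (\<lambda>_. 1) z"
      using *(1) by (auto simp: hankel_well_defined_def hankel_def hc intro: summable_sums)
  qed
  then show ?thesis
    using *(2) by (simp add: Dirichlet_space_iff_summable)
qed

section \<open>The symbol function and the equivalences\<close>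

lemma summable_on_nat_iff_of_support:
  fixes f :: "nat \<Rightarrow> real"
  assumes "\<And>n. 0 \<le> f n" "\<And>n. n \<notin> E \<Longrightarrow> f n = 0"
  shows "f summable_on E \<longleftrightarrow> summable f"
proof -
  have "f summable_on E \<longleftrightarrow> f summable_on UNIV"
    using assms(2) by (intro summable_on_cong_neutral) auto
  also have "\<dots> \<longleftrightarrow> summable f"
    using assms(1) by (intro summable_on_UNIV_nonneg_real_iff) auto
  finally show ?thesis .
qed

text \<open>The convergence clause turns the unordered sum over \<open>E\<close> into a power series
  with coefficients \<open>l\<close>. Conversely, the weighted condition gives absolute convergence
  in the disk, hence unordered summability.\<close>

lemma symbol_in_Dirichlet_iff:
  assumes l0: "\<And>n. n \<notin> E \<Longrightarrow> l n = 0"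
  shows "symbol_in_Dirichlet E l \<longleftrightarrow> summable (\<lambda>n. (real n + 1) * (norm (l n))\<^sup>2)"
proof
  assume *: "symbol_in_Dirichlet E l"
  have "(\<lambda>n. l n * z ^ n) sums symbol_function E l z" if "norm z < 1" for z
  proof -
    have "((\<lambda>n. l n * z ^ n) has_sum symbol_function E l z) E"
      using * that by (auto simp: symbol_in_Dirichlet_def symbol_function_def)
    also have "?this \<longleftrightarrow> ((\<lambda>n. l n * z ^ n) has_sum symbol_function E l z) UNIV"
      by (intro has_sum_cong_neutral) (auto simp: l0)
    finally show ?thesis
      by (rule has_sum_imp_sums)
  qed
  then have "taylor_coeff (symbol_function E l) = l"
    by (rule taylor_coeff_power_series)
  then show "summable (\<lambda>n. (real n + 1) * (norm (l n))\<^sup>2)"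
    using * by (simp add: symbol_in_Dirichlet_def Dirichlet_space_iff_summable)
next
  assume *: "summable (\<lambda>n. (real n + 1) * (norm (l n))\<^sup>2)"
  have has_sum: "((\<lambda>n. l n * z ^ n) has_sum (\<Sum>n. l n * z ^ n)) E" if "norm z < 1" for z
  proof -
    have "((\<lambda>n. l n * z ^ n) has_sum (\<Sum>n. l n * z ^ n)) UNIV"
      using summable_power_series_ball[OF * that]
      by (intro norm_summable_imp_has_sum summable_sums summable_norm_cancel[of "\<lambda>n. l n * z ^ n"])
    also have "?this \<longleftrightarrow> ?thesis"
      by (intro has_sum_cong_neutral) (auto simp: l0)
    finally show ?thesis .
  qed
  then have "symbol_function E l \<in> Dirichlet_space"
    using * by (intro Dirichlet_power_series(1)[of l]) (auto simp: symbol_function_def infsumI)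
  moreover have "(\<lambda>n. l n * z ^ n) summable_on E" if "norm z < 1" for z
    using has_sum[OF that] by (rule has_sum_imp_summable)
  ultimately show "symbol_in_Dirichlet E l"
    by (simp add: symbol_in_Dirichlet_def)
qed

theorem corollary1p5:
  fixes p :: real and E :: "nat set" and l :: "nat \<Rightarrow> complex"
  assumes "p > 2"
    and "Rudin_Lambda p (int ` E)"
    and "\<And>n. n \<notin> E \<Longrightarrow> l n = 0"
  shows "(hankel_compact l \<longleftrightarrow> hankel_bounded l) \<and>
         (hankel_bounded l \<longleftrightarrow> symbol_in_Dirichlet E (\<lambda>n. cnj (l n))) \<and>
         (symbol_in_Dirichlet E (\<lambda>n. cnj (l n)) \<longleftrightarrow>
            (\<lambda>n. (real n + 1) * (norm (l n))\<^sup>2) summable_on E)"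
proof -
  obtain K where K: "\<And>j N. (\<Sum>k<N. if j + k \<in> E then 1 / (real k + 1) else 0) \<le> K"
    using Rudin_Lambda_harmonic_bound[OF assms(1,2)] by blast
  \<comment> \<open>All conditions are compared with \<open>?S\<close>: compactness implies
    boundedness, boundedness implies \<open>?S\<close>, and \<open>?S\<close> implies
    compactness.\<close>
  let ?S = "summable (\<lambda>n. (real n + 1) * (norm (l n))\<^sup>2)"
  have "hankel_compact l" if ?S
    using K assms(3) that by (rule hankel_compact_of_summable)
  moreover have "hankel_bounded l" if "hankel_compact l"
    using that by (simp add: hankel_compact_def)
  moreover have ?S if "hankel_bounded l"
    using that by (rule summable_of_hankel_bounded)
  \<comment> \<open>Conjugation does not change the moduli of the coefficients.\<close>
  moreover have "symbol_in_Dirichlet E (\<lambda>n. cnj (l n)) \<longleftrightarrow> ?S"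
    using symbol_in_Dirichlet_iff[of E "\<lambda>n. cnj (l n)"] assms(3) by simp
  moreover have "(\<lambda>n. (real n + 1) * (norm (l n))\<^sup>2) summable_on E \<longleftrightarrow> ?S"
    using assms(3) by (intro summable_on_nat_iff_of_support) auto
  ultimately show ?thesis
    by blast
qed

end
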